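(* Let $(\Delta,\mathbf L)$ be the labelled rational Delzant polytope in $\mathfrak t^*\cong\mathbb R^m$ of a compact toric symplectic $2m$-manifold or orbifold, and $f$ an affine function which is positive on $\Delta$. Suppose there exists a smooth function $\mathbf H=(\mathbf H_{ij})$ on $\Delta$ with values in symmetric $(m\times m)$-matrices which satisfies, on each facet $F_j$ with inward normal $u_j=dL_j$, the boundary conditions $$\mathbf H_\xi(u_j,\cdot)=0,\qquad (d\mathbf H)_\xi(u_j,u_j)=2u_j\qquad(\xi\in F_j),$$ and the equation $$-\sum_{i,j=1}^m\Big(\frac1{f^{2m-1}}\mathbf H_{ij}\Big)_{,ij}=\frac c{f^{2m+1}}\qquad( * )$$ for a constant $c$. Then $c$ is the positive constant $$c_{\Delta,\mathbf L,f}=2\Big(\int_{\partial\Delta}\frac1{f^{2m-1}}d\sigma\Big)\Big/\Big(\int_\Delta\frac1{f^{2m+1}}d\mu\Big),$$ and the Donaldson–Futaki invariant $$\mathfrak F_{\Delta,\mathbf L,f}(\varphi)=2\int_{\partial\Delta}\frac{\varphi}{f^{2m-1}}d\sigma-c_{\Delta,\mathbf L,f}\int_\Delta\frac\varphi{f^{2m+1}}d\mu$$ vanishes for any affine function $\varphi$. If, furthermore, $\mathbf H$ is positive definite on the interior $\Delta^0$, in particular if $\mathbf H=\mathbf H^u$ for some $u\in\mathcal S(\Delta,\mathbf L)$ for which $\mathbf H^u$ satisfies $( * )$ with $c=c_{\Delta,\mathbf L,f}$, then $\mathfrak F_{\Delta,\mathbf L,f}(\varphi)\ge0$ for any smooth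 convex function $\varphi$ on $\Delta$, with equality if and only if $\varphi$ is affine.
   Context: $\mathfrak t$ is the Lie algebra of an $m$-dimensional torus $\mathbb T$ ($m\ge2$) with lattice of circle subgroups $\Lambda\subset\mathfrak t$. A labelled rational Delzant polytope $(\Delta,\mathbf L)$ consists of a compact convex polytope $\Delta=\{L_j\ge0,\ j=1,\dots,d\}\subset\mathfrak t^*$ with $d$ facets $F_j=\Delta\cap\{L_j=0\}$, $\mathbf L=(L_1,\dots,L_d)$ affine functions with inward normals $u_j=dL_j\in\Lambda\subset\mathfrak t$, such that the normals of the facets meeting at any vertex form a basis of $\mathfrak t$; these classify compact toric symplectic orbifolds. Identify $\mathfrak t\cong\mathbb R^m$ with coordinates $\mu_1,\dots,\mu_m$ on $\mathfrak t^*$; $\varphi_{,i}=\partial\varphi/\partial\mu_i$. $d\mu$ is Lebesgue measure on $\mathfrak t^*$, and $d\sigma$ is the measure on each facet $F_i$ defined by $dL_i\wedge d\sigma=-d\mu$. A symmetric-matrix-valued function $\mathbf H$ is viewed as $S^2\mathfrak t^*$-valued: $\mathbf H_\xi$ is a symmetric bilinear form on $\mathfrak t$, and $d\mathbf H$ is $S^2\mathfrak t^*\otimes\mathfrak t$-valued, so $(d\mathbf H)_\xi(u_j,u_j)\in\mathfrak t$. $\mathcal S(\Delta,\mathbf L)$ is the set of smooth strictly convex functions $u$ on $\Delta^0$ (positive definite Hessian) such that $\mathbf H^u:=(\mathrm{Hess}\,u)^{-1}$ (i) extends to a smooth function on $\Delta$, (ii) satisfies the boundary conditions displayed in the claim,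 and (iii) at each point $\xi$ in the interior of any face $F$ of $\Delta$, $\mathbf H^u_\xi$ is positive definite as a bilinear form on $\mathfrak t/\mathfrak t_F$, where $\mathfrak t_F$ is spanned by the normals $u_j$ of the facets containing $F$. *)

theory Defs
  imports "HOL-Analysis.Analysis"
begin

text \<open>
  Both the Lie algebra of the torus and its dual are identified with \<open>real ^ 'n\<close>, where
  \<open>m = CARD('n)\<close>; the pairing between them is the standard inner product.  An affine label is
  given by its normal \<open>u\<close> (its differential) and its constant term \<open>a\<close>.
\<close>

section \<open>Smooth functions\<close>

definition partial :: "'n \<Rightarrow> (real ^ 'n \<Rightarrow> 'b::real_normed_vector) \<Rightarrow> real ^ 'n::finite \<Rightarrow> 'b" where
  "partial i g x = frechet_derivative g (at x) (axis i 1)"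

definition hessian :: "(real ^ 'n::finite \<Rightarrow> real) \<Rightarrow> real ^ 'n \<Rightarrow> real ^ 'n ^ 'n" where
  "hessian g x = (\<chi> i j. partial j (partial i g) x)"

text \<open>The class \<open>C\<^sup>k\<close>; intended for open \<open>S\<close> only.\<close>

primrec Ck_on :: "nat \<Rightarrow> (real ^ 'n::finite) set \<Rightarrow> (real ^ 'n \<Rightarrow> 'b::real_normed_vector) \<Rightarrow> bool" where
  "Ck_on 0 S g \<longleftrightarrow> continuous_on S g"
| "Ck_on (Suc k) S g \<longleftrightarrow> (\<forall>x\<in>S. g differentiable (at x)) \<and> (\<forall>i. Ck_on k S (partial i g))"

text \<open>
  Smoothness on an arbitrary set means existence of a smooth extension to an open neighbourhood;
  only the values of \<open>g\<close> on \<open>S\<close> matter.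
\<close>

definition smooth_on :: "(real ^ 'n::finite) set \<Rightarrow> (real ^ 'n \<Rightarrow> 'b::real_normed_vector) \<Rightarrow> bool" where
  "smooth_on S g \<longleftrightarrow>
     (\<exists>V h. open V \<and> S \<subseteq> V \<and> (\<forall>k. Ck_on k V h) \<and> (\<forall>x\<in>S. h x = g x))"

definition affine_fun_on :: "(real ^ 'n::finite) set \<Rightarrow> (real ^ 'n \<Rightarrow> real) \<Rightarrow> bool" where
  "affine_fun_on S g \<longleftrightarrow> (\<exists>v b. \<forall>x\<in>S. g x = v \<bullet> x + b)"

definition pos_definite :: "real ^ 'n ^ 'n::finite \<Rightarrow> bool" where
  "pos_definite A \<longleftrightarrow> (\<forall>v. v \<noteq> 0 \<longrightarrow> 0 < v \<bullet> (A *v v))"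


section \<open>Labelled rational Delzant polytopes\<close>

definition is_lattice :: "(real ^ 'n::finite) set \<Rightarrow> bool" where
  "is_lattice \<Lambda> \<longleftrightarrow>
     (\<exists>B. independent B \<and> span B = UNIV \<and> \<Lambda> = range (\<lambda>k. \<Sum>b\<in>B. of_int (k b) *\<^sub>R b))"

definition label :: "(nat \<Rightarrow> real ^ 'n::finite) \<Rightarrow> (nat \<Rightarrow> real) \<Rightarrow> nat \<Rightarrow> real ^ 'n \<Rightarrow> real" where
  "label u a j x = u j \<bullet> x + a j"

definition polytope_of :: "nat \<Rightarrow> (nat \<Rightarrow> real ^ 'n::finite) \<Rightarrow> (nat \<Rightarrow> real) \<Rightarrow> (real ^ 'n) set" where
  "polytope_of d u a = {x. \<forall>j<d. 0 \<le> label u a j x}"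

definition facet :: "nat \<Rightarrow> (nat \<Rightarrow> real ^ 'n::finite) \<Rightarrow> (nat \<Rightarrow> real) \<Rightarrow> nat \<Rightarrow> (real ^ 'n) set" where
  "facet d u a j = {x \<in> polytope_of d u a. label u a j x = 0}"

definition labelled_delzant ::
  "(real ^ 'n::finite) set \<Rightarrow> nat \<Rightarrow> (nat \<Rightarrow> real ^ 'n) \<Rightarrow> (nat \<Rightarrow> real) \<Rightarrow> bool" where
  "labelled_delzant \<Lambda> d u a \<longleftrightarrow>
     is_lattice \<Lambda> \<and>
     compact (polytope_of d u a) \<and>
     interior (polytope_of d u a) \<noteq> {} \<and>
     (\<forall>j<d. facet d u a j facet_of polytope_of d u a) \<and>
     inj_on (facet d u a) {..<d} \<and>
     (\<forall>j<d. u j \<in> \<Lambda>) \<and>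
     (\<forall>v. v extreme_point_of polytope_of d u a \<longrightarrow>
        (let J = {j. j < d \<and> v \<in> facet d u a j}
         in inj_on u J \<and> independent (u ` J) \<and> span (u ` J) = UNIV))"


section \<open>The facet measures\<close>

text \<open>
  The positive measure \<open>\<sigma>\<close> on the hyperplane \<open>u \<bullet> x + b = 0\<close> with \<open>dL \<and> d\<sigma> = d\<mu>\<close> up to
  orientation, where \<open>L x = u \<bullet> x + b\<close>: the measure of a set \<open>E\<close> is the volume of the cylinder
  of points with \<open>0 \<le> L \<le> 1\<close> that lie over \<open>E\<close> along the vector \<open>u / (u \<bullet> u)\<close>, on which \<open>dL\<close>
  takes the value 1.  The lemma below is the identity \<open>d\<mu> = dL \<and> d\<sigma>\<close> in integrated form.
\<close>

definition hyperplane_measure :: "real ^ 'n::finite \<Rightarrow> real \<Rightarrow> (real ^ 'n) measure" where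
  "hyperplane_measure u b =
     distr (restrict_space lborel {x. 0 \<le> u \<bullet> x + b \<and> u \<bullet> x + b \<le> 1}) borel
       (\<lambda>x. x - ((u \<bullet> x + b) / (u \<bullet> u)) *\<^sub>R u)"

lemma hyperplane_measure_disintegration:
  fixes u :: "real ^ 'n::finite" and g :: "real ^ 'n \<Rightarrow> ennreal"
  assumes "u \<noteq> 0" and g[measurable]: "g \<in> borel_measurable borel"
  shows "(\<integral>\<^sup>+x. g x \<partial>lborel) =
         (\<integral>\<^sup>+t. (\<integral>\<^sup>+y. g (y + (t / (u \<bullet> u)) *\<^sub>R u) \<partial>hyperplane_measure u b) \<partial>lborel)"
proof -
  define L where "L = (\<lambda>x. u \<bullet> x + b)"
  define w where "w = u /\<^sub>R (u \<bullet> u)"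
  define S where "S = {x. 0 \<le> L x \<and> L x \<le> 1}"
  have uu: "u \<bullet> u \<noteq> 0" using assms by simp
  have [measurable]: "L \<in> borel_measurable borel" by (simp add: L_def)
  have Smeas[measurable]: "S \<in> sets borel" unfolding S_def by measurable
  have Lw: "L (x + s *\<^sub>R w) = L x + s" for x s
    using uu by (simp add: L_def w_def inner_right_distrib inner_commute)
  have proj: "x - (L x / (u \<bullet> u)) *\<^sub>R u = x - L x *\<^sub>R w" for x
    by (simp add: w_def divide_inverse_commute mult.commute)
  have step: "(t / (u \<bullet> u)) *\<^sub>R u = t *\<^sub>R w" for t
    by (simp add: w_def divide_inverse_commute mult.commute)
  have hm: "hyperplane_measure u b = distr (restrict_space lborel S) borel (\<lambda>x. x - L x *\<^sub>R w)"
    using proj by (simp add: hyperplane_measure_def S_def L_def)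
  have inner_int: "(\<integral>\<^sup>+y. g (y + t *\<^sub>R w) \<partial>hyperplane_measure u b) =
      (\<integral>\<^sup>+x. g (x + (t - L x) *\<^sub>R w) * indicator S x \<partial>lborel)" for t
  proof -
    have "(\<lambda>x. x - L x *\<^sub>R w) \<in> restrict_space lborel S \<rightarrow>\<^sub>M borel"
      by (rule measurable_restrict_space1) measurable
    then show ?thesis
      unfolding hm
      by (subst nn_integral_distr)
         (auto simp: nn_integral_restrict_space algebra_simps intro!: nn_integral_cong)
  qed
  have real_shift: "(\<integral>\<^sup>+t. h (t + c) \<partial>lborel) = (\<integral>\<^sup>+t. h t \<partial>lborel)"
    if "h \<in> borel_measurable borel" for h :: "real \<Rightarrow> ennreal" and c
    using nn_integral_real_affine[OF that, of 1 c] by (simp add: add.commute)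
  have vec_shift: "(\<integral>\<^sup>+x. h (c + x) \<partial>lborel) = (\<integral>\<^sup>+x. h x \<partial>lborel)"
    if [measurable]: "h \<in> borel_measurable borel" for h :: "real ^ 'n \<Rightarrow> ennreal" and c
    by (subst (2) lborel_distr_plus[of c, symmetric], subst nn_integral_distr) auto
  have "(\<integral>\<^sup>+t. (\<integral>\<^sup>+y. g (y + (t / (u \<bullet> u)) *\<^sub>R u) \<partial>hyperplane_measure u b) \<partial>lborel)
      = (\<integral>\<^sup>+t. (\<integral>\<^sup>+x. g (x + (t - L x) *\<^sub>R w) * indicator S x \<partial>lborel) \<partial>lborel)"
    by (simp add: step inner_int)
  also have "\<dots> = (\<integral>\<^sup>+x. (\<integral>\<^sup>+t. g (x + (t - L x) *\<^sub>R w) * indicator S x \<partial>lborel) \<partial>lborel)"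
    by (rule lborel_pair.Fubini') measurable
  also have "\<dots> = (\<integral>\<^sup>+x. (\<integral>\<^sup>+s. g (x + s *\<^sub>R w) * indicator S x \<partial>lborel) \<partial>lborel)"
  proof (rule nn_integral_cong)
    fix x
    have "(\<lambda>s. g (x + s *\<^sub>R w) * indicator S x) \<in> borel_measurable borel" by measurable
    from real_shift[OF this, of "- L x"]
    show "(\<integral>\<^sup>+t. g (x + (t - L x) *\<^sub>R w) * indicator S x \<partial>lborel) =
          (\<integral>\<^sup>+s. g (x + s *\<^sub>R w) * indicator S x \<partial>lborel)" by simp
  qed
  also have "\<dots> = (\<integral>\<^sup>+s. (\<integral>\<^sup>+x. g (x + s *\<^sub>R w) * indicator S x \<partial>lborel) \<partial>lborel)"
    by (rule lborel_pair.Fubini'[symmetric]) measurable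
  also have "\<dots> = (\<integral>\<^sup>+s. (\<integral>\<^sup>+x. g x * indicator S (x - s *\<^sub>R w) \<partial>lborel) \<partial>lborel)"
  proof (rule nn_integral_cong)
    fix s
    have "(\<lambda>x. g x * indicator S (x - s *\<^sub>R w)) \<in> borel_measurable borel" by measurable
    from vec_shift[OF this, of "s *\<^sub>R w"]
    show "(\<integral>\<^sup>+x. g (x + s *\<^sub>R w) * indicator S x \<partial>lborel) =
          (\<integral>\<^sup>+x. g x * indicator S (x - s *\<^sub>R w) \<partial>lborel)" by (simp add: add.commute)
  qed
  also have "\<dots> = (\<integral>\<^sup>+x. (\<integral>\<^sup>+s. g x * indicator S (x - s *\<^sub>R w) \<partial>lborel) \<partial>lborel)"
    by (rule lborel_pair.Fubini') measurable
  also have "\<dots> = (\<integral>\<^sup>+x. g x \<partial>lborel)"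
  proof (rule nn_integral_cong)
    fix x
    have "indicator S (x - s *\<^sub>R w) = (indicator {L x - 1..L x} s :: ennreal)" for s
      using Lw[of x "- s"] by (auto simp: S_def indicator_def)
    then show "(\<integral>\<^sup>+s. g x * indicator S (x - s *\<^sub>R w) \<partial>lborel) = g x"
      by (simp add: nn_integral_cmult_indicator)
  qed
  finally show ?thesis by simp
qed

definition boundary_integral ::
  "nat \<Rightarrow> (nat \<Rightarrow> real ^ 'n::finite) \<Rightarrow> (nat \<Rightarrow> real) \<Rightarrow> (real ^ 'n \<Rightarrow> real) \<Rightarrow> real" where
  "boundary_integral d u a g =
     (\<Sum>j<d. set_lebesgue_integral (hyperplane_measure (u j) (a j)) (facet d u a j) g)"

definition polytope_integral ::
  "nat \<Rightarrow> (nat \<Rightarrow> real ^ 'n::finite) \<Rightarrow> (nat \<Rightarrow> real) \<Rightarrow> (real ^ 'n \<Rightarrow> real) \<Rightarrow> real" where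
  "polytope_integral d u a g = set_lebesgue_integral lborel (polytope_of d u a) g"


section \<open>The Donaldson--Futaki invariant\<close>

definition c_const ::
  "nat \<Rightarrow> (nat \<Rightarrow> real ^ 'n::finite) \<Rightarrow> (nat \<Rightarrow> real) \<Rightarrow> (real ^ 'n \<Rightarrow> real) \<Rightarrow> real" where
  "c_const d u a f =
     2 * boundary_integral d u a (\<lambda>x. 1 / f x ^ (2 * CARD('n) - 1))
       / polytope_integral d u a (\<lambda>x. 1 / f x ^ (2 * CARD('n) + 1))"

definition futaki ::
  "nat \<Rightarrow> (nat \<Rightarrow> real ^ 'n::finite) \<Rightarrow> (nat \<Rightarrow> real) \<Rightarrow> (real ^ 'n \<Rightarrow> real) \<Rightarrow>
   (real ^ 'n \<Rightarrow> real) \<Rightarrow> real" where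
  "futaki d u a f \<phi> =
     2 * boundary_integral d u a (\<lambda>x. \<phi> x / f x ^ (2 * CARD('n) - 1))
       - c_const d u a f * polytope_integral d u a (\<lambda>x. \<phi> x / f x ^ (2 * CARD('n) + 1))"


section \<open>Boundary conditions, the equation, and symplectic potentials\<close>

text \<open>
  The vector equation \<open>(dH)\<^sub>\<xi>(u\<^sub>j, u\<^sub>j) = 2 u\<^sub>j\<close> is tested against all directions \<open>v\<close> in the dual
  of the Lie algebra.  Derivatives are taken within the polytope, so that the condition depends
  only on the values of \<open>H\<close> there; they are unique, the polytope being convex with nonempty
  interior.
\<close>

definition boundary_conditions ::
  "nat \<Rightarrow> (nat \<Rightarrow> real ^ 'n::finite) \<Rightarrow> (nat \<Rightarrow> real) \<Rightarrow> (real ^ 'n \<Rightarrow> real ^ 'n ^ 'n) \<Rightarrow> bool" where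
  "boundary_conditions d u a H \<longleftrightarrow>
     (\<forall>j<d. \<forall>\<xi>\<in>facet d u a j.
        H \<xi> *v u j = 0 \<and>
        (\<forall>v. u j \<bullet> (frechet_derivative H (at \<xi> within polytope_of d u a) v *v u j)
             = (2 *\<^sub>R u j) \<bullet> v))"

text \<open>Imposed on the interior; for \<open>H\<close> smooth up to the boundary it then holds on the polytope.\<close>

definition scal_equation ::
  "nat \<Rightarrow> (nat \<Rightarrow> real ^ 'n::finite) \<Rightarrow> (nat \<Rightarrow> real) \<Rightarrow> (real ^ 'n \<Rightarrow> real) \<Rightarrow>
   (real ^ 'n \<Rightarrow> real ^ 'n ^ 'n) \<Rightarrow> real \<Rightarrow> bool" where
  "scal_equation d u a f H c \<longleftrightarrow>
     (\<forall>\<xi>\<in>interior (polytope_of d u a).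
        - (\<Sum>i\<in>UNIV. \<Sum>j\<in>UNIV.
             partial j (partial i (\<lambda>x. 1 / f x ^ (2 * CARD('n) - 1) * H x $ i $ j)) \<xi>)
        = c / f \<xi> ^ (2 * CARD('n) + 1))"

definition H_of :: "(real ^ 'n::finite \<Rightarrow> real) \<Rightarrow> real ^ 'n \<Rightarrow> real ^ 'n ^ 'n" where
  "H_of U \<xi> = matrix_inv (hessian U \<xi>)"

text \<open>
  Positive definiteness of a form on the quotient by the span \<open>T\<close> of some of the normals means
  positivity on all vectors outside \<open>T\<close>; the form descends to the quotient by the boundary
  conditions.
\<close>

definition symplectic_potentials ::
  "nat \<Rightarrow> (nat \<Rightarrow> real ^ 'n::finite) \<Rightarrow> (nat \<Rightarrow> real) \<Rightarrow> (real ^ 'n \<Rightarrow> real) set" where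
  "symplectic_potentials d u a =
     {U. smooth_on (interior (polytope_of d u a)) U \<and>
         (\<forall>\<xi>\<in>interior (polytope_of d u a). pos_definite (hessian U \<xi>)) \<and>
         (\<exists>G. smooth_on (polytope_of d u a) G \<and>
              (\<forall>\<xi>\<in>interior (polytope_of d u a). G \<xi> = H_of U \<xi>) \<and>
              boundary_conditions d u a G \<and>
              (\<forall>F. F face_of polytope_of d u a \<longrightarrow>
                 (\<forall>\<xi>\<in>rel_interior F. \<forall>v.
                    v \<notin> span (u ` {j. j < d \<and> F \<subseteq> facet d u a j}) \<longrightarrow> 0 < v \<bullet> (G \<xi> *v v))))}"

end

theory Submission
  imports Defs
begin

text \<open>
  Write \<open>m = CARD('n)\<close>, \<open>p = 1 / f^(2m-1)\<close> and \<open>h = p H\<close>, with a comma for partial derivatives.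
  Everything follows from one identity, valid for every smooth \<open>\<phi>\<close> on \<open>\<Delta>\<close>
  (\<open>weighted_integration_by_parts\<close>):
  \<open>2 \<integral>\<^bsub>\<partial>\<Delta>\<^esub> p \<phi> d\<sigma> = c \<integral>\<^bsub>\<Delta>\<^esub> \<phi> / f^(2m+1) d\<mu> + \<integral>\<^bsub>\<Delta>\<^esub> (\<Sum>ij. h_ij \<phi>_,ij) d\<mu>\<close>.
  It is the divergence theorem for the field \<open>Y_j = \<Sum>i. (\<phi> h_ij,i - h_ji \<phi>_,i)\<close>.  The first-order
  terms of its divergence cancel, and the equation for \<open>H\<close> rewrites the term in \<open>h_ij,ij\<close>.  On a facet
  with normal \<open>u\<close> the vector field \<open>H u\<close> vanishes, so its derivative there is nonzero only in the normal
  direction, and \<open>dH(u,u) = 2u\<close> says that its divergence is 2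
  (\<open>boundary_conditions_divergence\<close>); hence the component of \<open>Y\<close> along \<open>u\<close> is \<open>2 p \<phi>\<close>.

  With \<open>\<phi> = 1\<close> the identity determines \<open>c\<close>, as a quotient of two positive integrals.  With that value
  of \<open>c\<close> it says that the Donaldson--Futaki invariant of \<open>\<phi>\<close> is the integral of
  \<open>\<Sum>ij. h_ij \<phi>_,ij\<close>.  This is zero for affine \<open>\<phi>\<close>.  If \<open>H\<close> is positive definite on the interior and
  \<open>\<phi>\<close> is convex, the integrand is a trace of a product of a positive definite and a positive
  semidefinite form, so it is nonnegative (\<open>sum_mult_psd_nonneg\<close>) and vanishes only where the Hessian
  of \<open>\<phi>\<close> does (\<open>sum_mult_pos_definite_eq_0\<close>); if the integral is zero, \<open>\<phi>\<close> is affine.  For a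
  symplectic potential \<open>U\<close> the form \<open>H\<close> is the smooth extension of the inverse Hessian of \<open>U\<close>, which is
  symmetric because mixed partial derivatives commute.

  The divergence theorem itself (\<open>polytope_divergence\<close>) is obtained from translation invariance of
  Lebesgue measure: \<open>\<integral>\<^bsub>\<Delta>\<^esub> (g (x + hv) - g x) / h\<close> equals
  \<open>\<integral> g(x) (1\<^bsub>\<Delta>\<^esub>(x - hv) - 1\<^bsub>\<Delta>\<^esub>(x)) / h\<close>.  The indicator of \<open>\<Delta>\<close> is the product of the indicators
  of its half-spaces, so the difference telescopes into one term for each facet, supported on a slab of
  width proportional to \<open>h\<close> (\<open>slab_limit\<close>).  Stretching the slab to the unit slab of the definition of
  \<open>hyperplane_measure\<close> turns the limit \<open>h \<rightarrow> 0\<close> into an application of dominated convergence.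
\<close>

section \<open>Stretching along the normal of a hyperplane\<close>

text \<open>
  The affine map that fixes the hyperplane \<open>u \<bullet> x + b = 0\<close>, moves points along \<open>u\<close> and multiplies
  \<open>u \<bullet> x + b\<close> by \<open>\<tau>\<close>.  For \<open>\<tau> = 0\<close> it is the projection used to define \<open>hyperplane_measure u b\<close>; as
  \<open>\<tau>\<close> tends to 0 it flattens the unit slab onto the hyperplane.
\<close>

definition slide :: "real ^ 'n::finite \<Rightarrow> real \<Rightarrow> real \<Rightarrow> real ^ 'n \<Rightarrow> real ^ 'n" where
  "slide u b \<tau> x = x - ((1 - \<tau>) * (u \<bullet> x + b) / (u \<bullet> u)) *\<^sub>R u"

lemma slide_measurable [measurable]: "slide u b \<tau> \<in> borel_measurable borel"
  unfolding slide_def by measurable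

lemma level_slide:
  assumes "u \<noteq> 0"
  shows "u \<bullet> slide u b \<tau> x + b = \<tau> * (u \<bullet> x + b)"
  using assms by (simp add: slide_def inner_diff_right field_simps)

lemma hyperplane_measure_eq_distr_slide:
  "hyperplane_measure u b
    = distr (restrict_space lborel {x. 0 \<le> u \<bullet> x + b \<and> u \<bullet> x + b \<le> 1}) borel (slide u b 0)"
proof -
  have "slide u b 0 = (\<lambda>x. x - ((u \<bullet> x + b) / (u \<bullet> u)) *\<^sub>R u)"
    by (simp add: slide_def fun_eq_iff)
  then show ?thesis
    by (simp add: hyperplane_measure_def)
qed

text \<open>
  The Jacobian of \<open>slide u b \<tau>\<close> is \<open>\<tau>\<close>.  Disintegrating both integrals along the hyperplanes parallel
  to \<open>u \<bullet> x + b = 0\<close> reduces this to the substitution \<open>t \<mapsto> \<tau> t\<close> on the line.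
\<close>

lemma nn_integral_slide:
  fixes u :: "real ^ 'n::finite" and G :: "real ^ 'n \<Rightarrow> ennreal"
  assumes u: "u \<noteq> 0" and "\<tau> \<noteq> 0" and G[measurable]: "G \<in> borel_measurable borel"
  shows "(\<integral>\<^sup>+x. G x \<partial>lborel) = ennreal \<bar>\<tau>\<bar> * (\<integral>\<^sup>+x. G (slide u b \<tau> x) \<partial>lborel)"
proof -
  define S where "S = {x. 0 \<le> u \<bullet> x + b \<and> u \<bullet> x + b \<le> 1}"
  have [measurable]: "S \<in> sets borel" unfolding S_def by measurable
  have uu: "u \<bullet> u \<noteq> 0" using u by simp
  define \<Phi> where
    "\<Phi> = (\<lambda>t. \<integral>\<^sup>+x. G (slide u b 0 x + (t / (u \<bullet> u)) *\<^sub>R u) * indicator S x \<partial>lborel)"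
  have hm: "(\<integral>\<^sup>+y. g y \<partial>hyperplane_measure u b)
      = (\<integral>\<^sup>+x. g (slide u b 0 x) * indicator S x \<partial>lborel)"
    if [measurable]: "g \<in> borel_measurable borel" for g :: "real ^ 'n \<Rightarrow> ennreal"
  proof -
    have "hyperplane_measure u b = distr (restrict_space lborel S) borel (slide u b 0)"
      by (simp add: hyperplane_measure_eq_distr_slide S_def)
    moreover have "slide u b 0 \<in> restrict_space lborel S \<rightarrow>\<^sub>M borel"
      by (rule measurable_restrict_space1) measurable
    ultimately show ?thesis
      by (simp add: nn_integral_distr nn_integral_restrict_space)
  qed
  have "(\<integral>\<^sup>+x. G (slide u b \<tau> x) \<partial>lborel)
     = (\<integral>\<^sup>+t. (\<integral>\<^sup>+y. G (slide u b \<tau> (y + (t / (u \<bullet> u)) *\<^sub>R u)) \<partial>hyperplane_measure u b) \<partial>lborel)"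
    using u by (intro hyperplane_measure_disintegration) measurable
  also have "\<dots> = (\<integral>\<^sup>+t. \<Phi> (\<tau> * t) \<partial>lborel)"
  proof (rule nn_integral_cong)
    fix t :: real
    have *: "slide u b \<tau> (slide u b 0 x + (t / (u \<bullet> u)) *\<^sub>R u)
        = slide u b 0 x + (\<tau> * t / (u \<bullet> u)) *\<^sub>R u" for x
    proof -
      have "u \<bullet> (slide u b 0 x + (t / (u \<bullet> u)) *\<^sub>R u) + b = t"
        using level_slide[OF u, of b 0 x] uu by (simp add: inner_add_right)
      then show ?thesis
        unfolding slide_def[of u b \<tau>]
        by (simp add: algebra_simps diff_divide_distrib flip: scaleR_add_left)
    qed
    show "(\<integral>\<^sup>+y. G (slide u b \<tau> (y + (t / (u \<bullet> u)) *\<^sub>R u)) \<partial>hyperplane_measure u b) = \<Phi> (\<tau> * t)"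
      by (subst hm) (simp_all add: * \<Phi>_def)
  qed
  finally have 1: "(\<integral>\<^sup>+x. G (slide u b \<tau> x) \<partial>lborel) = (\<integral>\<^sup>+t. \<Phi> (\<tau> * t) \<partial>lborel)" .
  have [measurable]: "\<Phi> \<in> borel_measurable borel"
    unfolding \<Phi>_def by measurable
  have "(\<integral>\<^sup>+x. G x \<partial>lborel)
      = (\<integral>\<^sup>+t. (\<integral>\<^sup>+y. G (y + (t / (u \<bullet> u)) *\<^sub>R u) \<partial>hyperplane_measure u b) \<partial>lborel)"
    using u by (intro hyperplane_measure_disintegration) measurable
  also have "\<dots> = (\<integral>\<^sup>+t. \<Phi> t \<partial>lborel)"
    by (intro nn_integral_cong) (simp add: hm \<Phi>_def)
  also have "\<dots> = ennreal \<bar>\<tau>\<bar> * (\<integral>\<^sup>+t. \<Phi> (\<tau> * t) \<partial>lborel)"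
    using nn_integral_real_affine[of \<Phi> \<tau> 0] \<open>\<tau> \<noteq> 0\<close> by simp
  finally show ?thesis using 1 by simp
qed

lemma lborel_eq_density_slide:
  fixes u :: "real ^ 'n::finite"
  assumes u: "u \<noteq> 0" and "\<tau> \<noteq> 0"
  shows "lborel = density (distr lborel borel (slide u b \<tau>)) (\<lambda>_. ennreal \<bar>\<tau>\<bar>)"
proof (rule measure_eqI)
  fix A :: "(real ^ 'n) set" assume "A \<in> sets lborel"
  then have [measurable]: "A \<in> sets borel" by simp
  have "emeasure lborel A = ennreal \<bar>\<tau>\<bar> * (\<integral>\<^sup>+x. indicator A (slide u b \<tau> x) \<partial>lborel)"
    using nn_integral_slide[OF assms, of "indicator A" b] by simp
  also have "(\<integral>\<^sup>+x. indicator A (slide u b \<tau> x) \<partial>lborel) = (\<integral>\<^sup>+x. indicator A x \<partial>distr lborel borel (slide u b \<tau>))"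
    by (subst nn_integral_distr) auto
  finally show "emeasure lborel A = emeasure (density (distr lborel borel (slide u b \<tau>)) (\<lambda>_. ennreal \<bar>\<tau>\<bar>)) A"
    by (simp add: emeasure_density nn_integral_cmult)
qed simp

lemma integral_slide:
  fixes u :: "real ^ 'n::finite" and G :: "real ^ 'n \<Rightarrow> real"
  assumes u: "u \<noteq> 0" and "\<tau> \<noteq> 0" and G[measurable]: "G \<in> borel_measurable borel"
  shows "(\<integral>x. G x \<partial>lborel) = \<bar>\<tau>\<bar> * (\<integral>x. G (slide u b \<tau> x) \<partial>lborel)"
  by (subst lborel_eq_density_slide[OF assms(1,2), of b])
     (simp add: integral_density integral_distr)

lemma set_integral_hyperplane_measure:
  fixes u :: "real ^ 'n::finite" and g :: "real ^ 'n \<Rightarrow> real"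
  assumes [measurable]: "(\<lambda>x. indicator F x * g x) \<in> borel_measurable borel"
  shows "set_lebesgue_integral (hyperplane_measure u b) F g =
    (\<integral>x. indicator {0..1} (u \<bullet> x + b) * (indicator F (slide u b 0 x) * g (slide u b 0 x)) \<partial>lborel)"
proof -
  define S where "S = {x. 0 \<le> u \<bullet> x + b \<and> u \<bullet> x + b \<le> 1}"
  have S[measurable]: "S \<in> sets borel" unfolding S_def by measurable
  have "hyperplane_measure u b = distr (restrict_space lborel S) borel (slide u b 0)"
    by (simp add: hyperplane_measure_eq_distr_slide S_def)
  moreover have "slide u b 0 \<in> restrict_space lborel S \<rightarrow>\<^sub>M borel"
    by (rule measurable_restrict_space1) measurable
  ultimately have "set_lebesgue_integral (hyperplane_measure u b) F g
      = (\<integral>x. indicator S x * (indicator F (slide u b 0 x) * g (slide u b 0 x)) \<partial>lborel)"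
    by (simp add: set_lebesgue_integral_def integral_distr integral_restrict_space)
  also have "\<dots> = (\<integral>x. indicator {0..1} (u \<bullet> x + b) * (indicator F (slide u b 0 x) * g (slide u b 0 x)) \<partial>lborel)"
    by (intro Bochner_Integration.integral_cong) (auto simp: S_def indicator_def)
  finally show ?thesis .
qed

lemma AE_not_in_hyperplane:
  fixes n :: "real ^ 'n::finite"
  assumes "n \<noteq> 0 \<or> c \<noteq> 0"
  shows "AE x in lborel. n \<bullet> x + c \<noteq> 0"
proof -
  have "{x. n \<bullet> x = - c} \<in> null_sets lebesgue"
    using negligible_hyperplane[of n "- c"] assms by (auto simp: negligible_iff_null_sets)
  moreover have "{x. n \<bullet> x = - c} \<in> sets lborel" by simp
  ultimately have "{x. n \<bullet> x = - c} \<in> null_sets lborel"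
    using null_sets_completion_iff by blast
  then show ?thesis
    by (rule AE_I'[of "{x. n \<bullet> x = - c}"]) (auto simp: add_eq_0_iff2)
qed

text \<open>
  Two distinct hyperplanes meet in a null set of either: \<open>u' \<bullet> slide u b 0 x + b'\<close> is an affine function
  of \<open>x\<close> which is not identically zero, as \<open>slide u b 0\<close> fixes \<open>y\<close>.
\<close>

lemma AE_slide_hyperplane:
  fixes u :: "real ^ 'n::finite"
  assumes "u \<bullet> y + b = 0" "u' \<bullet> y + b' \<noteq> 0"
  shows "AE x in lborel. u' \<bullet> slide u b 0 x + b' \<noteq> 0"
proof -
  define n where "n = u' - ((u' \<bullet> u) / (u \<bullet> u)) *\<^sub>R u"
  define c where "c = b' - b * (u' \<bullet> u) / (u \<bullet> u)"
  have eq: "u' \<bullet> slide u b 0 x + b' = n \<bullet> x + c" for x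
    by (simp add: slide_def n_def c_def inner_diff_left inner_diff_right add_divide_distrib algebra_simps)
  \<comment> \<open>the projection fixes the given point of the hyperplane\<close>
  have "n \<noteq> 0 \<or> c \<noteq> 0"
    using eq[of y] assms by (auto simp: slide_def)
  from AE_not_in_hyperplane[OF this] show ?thesis
    by (simp add: eq)
qed

lemma integrable_bounded_support:
  fixes G :: "real ^ 'n::finite \<Rightarrow> real"
  assumes [measurable]: "G \<in> borel_measurable borel"
    and "bounded K" "\<And>x. \<bar>G x\<bar> \<le> M" "\<And>x. x \<notin> K \<Longrightarrow> G x = 0"
  shows "integrable lborel G"
proof -
  obtain R where R: "K \<subseteq> cball 0 R"
    using \<open>bounded K\<close> by (auto simp: bounded_iff subset_iff)
  have "integrable lborel (\<lambda>x. indicator (cball 0 R) x * M :: real)"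
    by (intro integrable_mult_left integrable_real_indicator)
       (use emeasure_lborel_cball_finite in auto)
  then show ?thesis
  proof (rule Bochner_Integration.integrable_bound)
    have "\<bar>G x\<bar> \<le> \<bar>indicator (cball 0 R) x * M\<bar>" for x
    proof (cases "x \<in> K")
      case True
      then have "x \<in> cball 0 R" using R by blast
      then show ?thesis using assms(3)[of x] by simp
    qed (simp add: assms(4))
    then show "AE x in lborel. norm (G x) \<le> norm (indicator (cball 0 R) x * M)"
      by simp
  qed simp
qed

text \<open>
  The contribution of a single facet to the divergence theorem.  The difference of the two truth
  values is, up to sign, the indicator of the slab between the levels 0 and \<open>h n * \<alpha>\<close> of
  \<open>L x = u \<bullet> x + b\<close>.  The substitution \<open>x = slide u b (h n * \<alpha>) z\<close> makes it the slab \<open>0 \<le> L z \<le> 1\<close>,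
  and its Jacobian \<open>\<bar>h n * \<alpha>\<bar>\<close> cancels the factor \<open>1 / h n\<close>.  The functions \<open>G n\<close> may depend on \<open>n\<close>,
  because they will contain the indicators of the other half-spaces, some of them translated.
\<close>

lemma slab_limit:
  fixes u :: "real ^ 'n::finite" and G :: "nat \<Rightarrow> real ^ 'n \<Rightarrow> real"
  assumes u: "u \<noteq> 0"
    and G[measurable]: "\<And>n. G n \<in> borel_measurable borel"
    and \<Phi>[measurable]: "\<Phi> \<in> borel_measurable borel"
    and K: "bounded K" and bound: "\<And>n x. \<bar>G n x\<bar> \<le> M" and supp: "\<And>n x. x \<notin> K \<Longrightarrow> G n x = 0"
    and h: "\<And>n. 0 < h n" "\<And>n. h n \<le> 1"
    and lim: "AE z in lborel. (\<lambda>n. G n (slide u b (h n * \<alpha>) z)) \<longlonglongrightarrow> \<Phi> (slide u b 0 z)"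
  shows "(\<lambda>n. \<integral>x. G n x * ((of_bool (h n * \<alpha> \<le> u \<bullet> x + b) - of_bool (0 \<le> u \<bullet> x + b)) / h n) \<partial>lborel)
    \<longlonglongrightarrow> - \<alpha> * (\<integral>z. indicator {0..1} (u \<bullet> z + b) * \<Phi> (slide u b 0 z) \<partial>lborel)"
proof (cases "\<alpha> = 0")
  case True
  then show ?thesis by simp
next
  case False
  obtain R where R: "\<And>x. x \<in> K \<Longrightarrow> norm x \<le> R"
    using K by (auto simp: bounded_iff)
  define r where "r = R + (1 + \<bar>\<alpha>\<bar>) / norm u"
  have M: "0 \<le> M" using bound[of 0 0] by linarith
  have eq: "(\<integral>x. G n x * ((of_bool (h n * \<alpha> \<le> u \<bullet> x + b) - of_bool (0 \<le> u \<bullet> x + b)) / h n) \<partial>lborel)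
     = - \<alpha> * (\<integral>z. indicator {0..1} (u \<bullet> z + b) * G n (slide u b (h n * \<alpha>) z) \<partial>lborel)" for n
  proof -
    have hn: "h n > 0" by (rule h)
    have "(\<integral>x. G n x * ((of_bool (h n * \<alpha> \<le> u \<bullet> x + b) - of_bool (0 \<le> u \<bullet> x + b)) / h n) \<partial>lborel)
      = \<bar>h n * \<alpha>\<bar> * (\<integral>z. G n (slide u b (h n * \<alpha>) z) * ((of_bool (h n * \<alpha> \<le> h n * \<alpha> * (u \<bullet> z + b))
           - of_bool (0 \<le> h n * \<alpha> * (u \<bullet> z + b))) / h n) \<partial>lborel)"
      using False hn by (subst integral_slide[OF u, of "h n * \<alpha>" _ b]) (simp_all add: level_slide[OF u])
    also have "\<dots> = (\<integral>z. \<bar>h n * \<alpha>\<bar> * (G n (slide u b (h n * \<alpha>) z) * ((of_bool (h n * \<alpha> \<le> h n * \<alpha> * (u \<bullet> z + b))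
           - of_bool (0 \<le> h n * \<alpha> * (u \<bullet> z + b))) / h n)) \<partial>lborel)"
      by simp
    also have "\<dots> = (\<integral>z. - \<alpha> * (indicator {0..1} (u \<bullet> z + b) * G n (slide u b (h n * \<alpha>) z)) \<partial>lborel)"
    \<comment> \<open>the levels 0 and 1 are excluded: there strict and weak inequalities differ\<close>
    proof (rule integral_cong_AE)
      have "AE z in lborel. u \<bullet> z + b \<noteq> 0" "AE z in lborel. u \<bullet> z + (b - 1) \<noteq> 0"
        using u by (auto intro!: AE_not_in_hyperplane)
      then show "AE z in lborel. \<bar>h n * \<alpha>\<bar> * (G n (slide u b (h n * \<alpha>) z) * ((of_bool (h n * \<alpha> \<le> h n * \<alpha> * (u \<bullet> z + b))
           - of_bool (0 \<le> h n * \<alpha> * (u \<bullet> z + b))) / h n))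
        = - \<alpha> * (indicator {0..1} (u \<bullet> z + b) * G n (slide u b (h n * \<alpha>) z))"
      proof eventually_elim
        case (elim z)
        define l where "l = u \<bullet> z + b"
        have l: "l \<noteq> 0" "l \<noteq> 1" using elim by (auto simp: l_def)
        have "\<bar>h n * \<alpha>\<bar> * ((of_bool (h n * \<alpha> \<le> h n * \<alpha> * l) - of_bool (0 \<le> h n * \<alpha> * l)) / h n)
            = - \<alpha> * indicator {0..1} l"
        proof (cases "\<alpha> > 0")
          case True
          then have "h n * \<alpha> \<le> h n * \<alpha> * l \<longleftrightarrow> 1 \<le> l" "0 \<le> h n * \<alpha> * l \<longleftrightarrow> 0 \<le> l"
            using mult_pos_pos[OF hn True] hn True
            by (auto simp: zero_le_mult_iff mult_le_cancel_left1 mult_less_0_iff mult_le_0_iff)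
          then show ?thesis using True hn l by (auto simp: abs_mult indicator_def)
        next
          case nle: False
          then have "\<alpha> < 0" using False by simp
          then have "h n * \<alpha> < 0" using hn by (simp add: mult_pos_neg)
          then have "h n * \<alpha> \<le> h n * \<alpha> * l \<longleftrightarrow> l \<le> 1" "0 \<le> h n * \<alpha> * l \<longleftrightarrow> l \<le> 0"
            using hn \<open>\<alpha> < 0\<close>
            by (auto simp: zero_le_mult_iff mult_le_cancel_left1 mult_less_0_iff mult_le_0_iff
                zero_less_mult_iff)
          then show ?thesis using \<open>\<alpha> < 0\<close> hn l by (auto simp: abs_mult indicator_def)
        qed
        from arg_cong[OF this, of "\<lambda>c. c * G n (slide u b (h n * \<alpha>) z)"]
        show ?case by (simp add: l_def mult_ac)
      qed
    qed measurable
    finally show ?thesis by simp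
  qed
  have "(\<lambda>n. \<integral>z. indicator {0..1} (u \<bullet> z + b) * G n (slide u b (h n * \<alpha>) z) \<partial>lborel)
     \<longlonglongrightarrow> (\<integral>z. indicator {0..1} (u \<bullet> z + b) * \<Phi> (slide u b 0 z) \<partial>lborel)"
  proof (rule integral_dominated_convergence)
    show "integrable lborel (\<lambda>z::real^'n. indicator (cball 0 r) z * M :: real)"
      by (intro integrable_mult_left integrable_real_indicator)
         (use emeasure_lborel_cball_finite in auto)
    show "AE z in lborel. (\<lambda>n. indicator {0..1} (u \<bullet> z + b) * G n (slide u b (h n * \<alpha>) z))
       \<longlonglongrightarrow> indicator {0..1} (u \<bullet> z + b) * \<Phi> (slide u b 0 z)"
      using lim by eventually_elim (rule tendsto_mult_left)
    show "AE z in lborel. norm (indicator {0..1} (u \<bullet> z + b) * G n (slide u b (h n * \<alpha>) z))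
       \<le> indicator (cball 0 r) z * M" for n
    proof (rule AE_I2)
      fix z
      show "norm (indicator {0..1} (u \<bullet> z + b) * G n (slide u b (h n * \<alpha>) z)) \<le> indicator (cball 0 r) z * M"
      proof (cases "slide u b (h n * \<alpha>) z \<in> K \<and> u \<bullet> z + b \<in> {0..1}")
        case True
        \<comment> \<open>The points that slide into the bounded set K from the unit slab form a bounded set,
            independently of n.\<close>
        define s where "s = ((1 - h n * \<alpha>) * (u \<bullet> z + b) / (u \<bullet> u))"
        have "\<bar>h n * \<alpha>\<bar> \<le> 1 * \<bar>\<alpha>\<bar>"
          unfolding abs_mult using h[of n] by (intro mult_right_mono) auto
        then have "\<bar>1 - h n * \<alpha>\<bar> * \<bar>u \<bullet> z + b\<bar> \<le> (1 + \<bar>\<alpha>\<bar>) * 1"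
          using True by (intro mult_mono) auto
        then have "\<bar>1 - h n * \<alpha>\<bar> * \<bar>u \<bullet> z + b\<bar> / norm u \<le> (1 + \<bar>\<alpha>\<bar>) / norm u"
          by (intro divide_right_mono) auto
        moreover have "\<bar>s\<bar> * norm u = \<bar>1 - h n * \<alpha>\<bar> * \<bar>u \<bullet> z + b\<bar> / norm u"
          using u by (simp add: s_def abs_mult dot_square_norm power2_eq_square)
        ultimately have "\<bar>s\<bar> * norm u \<le> (1 + \<bar>\<alpha>\<bar>) / norm u"
          by simp
        moreover have "z = slide u b (h n * \<alpha>) z + s *\<^sub>R u"
          by (simp add: slide_def s_def)
        then have "norm z \<le> norm (slide u b (h n * \<alpha>) z) + \<bar>s\<bar> * norm u"
          by (metis norm_scaleR norm_triangle_ineq)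
        ultimately have "norm z \<le> r"
          using R True by (force simp: r_def)
        then show ?thesis
          using bound[of n] M by (simp add: indicator_def)
      next
        case False
        then have 0: "indicator {0..1} (u \<bullet> z + b) * G n (slide u b (h n * \<alpha>) z) = 0"
          using supp by (auto simp: indicator_def)
        show ?thesis unfolding 0 using M by simp
      qed
    qed
  qed measurable
  then show ?thesis unfolding eq by (rule tendsto_mult_left)
qed

text \<open>
  Factors before the index \<open>j\<close> have already been changed from \<open>B\<close> to \<open>A\<close>, the later ones not yet.
\<close>

lemma prod_telescope:
  fixes A B :: "nat \<Rightarrow> 'a::comm_ring_1"
  shows "(\<Prod>k<d. A k) - (\<Prod>k<d. B k)
    = (\<Sum>j<d. (\<Prod>k<j. A k) * (A j - B j) * (\<Prod>k\<in>{j<..<d}. B k))"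
proof (induction d)
  case (Suc d)
  have "{j<..<Suc d} = insert d {j<..<d}" if "j < d" for j
    using that by auto
  then have "(\<Sum>j<d. (\<Prod>k<j. A k) * (A j - B j) * (\<Prod>k\<in>{j<..<Suc d}. B k))
     = (\<Sum>j<d. (\<Prod>k<j. A k) * (A j - B j) * (\<Prod>k\<in>{j<..<d}. B k)) * B d"
    by (simp add: sum_distrib_right sum_distrib_left mult_ac)
  then have *: "(\<Sum>j<d. (\<Prod>k<j. A k) * (A j - B j) * (\<Prod>k\<in>{j<..<Suc d}. B k))
     = ((\<Prod>k<d. A k) - (\<Prod>k<d. B k)) * B d"
    by (simp only: Suc)
  have "{d<..<Suc d} = {}" by auto
  then show ?case
    unfolding lessThan_Suc by (simp add: *) (simp add: algebra_simps)
qed simp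

lemma tendsto_of_bool_nonneg:
  fixes s :: "nat \<Rightarrow> real"
  assumes "s \<longlonglongrightarrow> l" "l \<noteq> 0"
  shows "(\<lambda>n. of_bool (0 \<le> s n) :: real) \<longlonglongrightarrow> of_bool (0 \<le> l)"
proof (cases "l > 0")
  case True
  then have "eventually (\<lambda>n. s n > 0) sequentially"
    using assms order_tendstoD by blast
  then have "eventually (\<lambda>n. of_bool (0 \<le> s n) = (of_bool (0 \<le> l) :: real)) sequentially"
    by eventually_elim (use True in auto)
  then show ?thesis by (rule tendsto_eventually)
next
  case False
  then have "eventually (\<lambda>n. s n < 0) sequentially"
    using assms order_tendstoD(2)[of s l sequentially 0] by auto
  then have "eventually (\<lambda>n. of_bool (0 \<le> s n) = (of_bool (0 \<le> l) :: real)) sequentially"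
    by eventually_elim (use False assms in auto)
  then show ?thesis by (rule tendsto_eventually)
qed

section \<open>The divergence theorem on a polytope\<close>

lemma closed_polytope_of: "closed (polytope_of d u a)"
proof -
  have "polytope_of d u a = (\<Inter>j\<in>{..<d}. {x. 0 \<le> u j \<bullet> x + a j})"
    by (auto simp: polytope_of_def label_def)
  then show ?thesis
    by (auto intro!: closed_INT closed_Collect_le continuous_intros)
qed

lemma closed_facet: "closed (facet d u a j)"
proof -
  have "facet d u a j = polytope_of d u a \<inter> {x. u j \<bullet> x + a j = 0}"
    by (auto simp: facet_def label_def)
  then show ?thesis
    by (auto intro!: closed_Int closed_polytope_of closed_Collect_eq continuous_intros)
qed

lemma facet_subset: "facet d u a j \<subseteq> polytope_of d u a"
  by (auto simp: facet_def)

lemma indicator_mult_borel: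
  fixes g :: "real ^ 'n::finite \<Rightarrow> real"
  assumes "closed S" "continuous_on S g"
  shows "(\<lambda>x. indicator S x * g x) \<in> borel_measurable borel"
  using borel_measurable_continuous_on_indicator[OF _ assms(2)] assms(1) by simp

lemma has_real_derivative_along_line:
  fixes g :: "'a::real_normed_vector \<Rightarrow> real"
  assumes "(g has_derivative D) (at (x + t *\<^sub>R v))"
  shows "((\<lambda>t. g (x + t *\<^sub>R v)) has_real_derivative D v) (at t)"
proof -
  have "((\<lambda>t. x + t *\<^sub>R v) has_derivative (\<lambda>s. s *\<^sub>R v)) (at t)"
    by (auto intro!: derivative_eq_intros)
  from has_derivative_compose[OF this, of g D] assms
  have "((\<lambda>t. g (x + t *\<^sub>R v)) has_derivative (\<lambda>s. D (s *\<^sub>R v))) (at t)"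
    by simp
  moreover have "D (s *\<^sub>R v) = D v * s" for s
    using linear_cmul[OF has_derivative_linear[OF assms]] by simp
  ultimately show ?thesis
    by (simp add: has_field_derivative_def)
qed

text \<open>
  The domination needed to differentiate under the integral.
\<close>

lemma difference_quotient_bound:
  fixes g :: "real ^ 'n::finite \<Rightarrow> real"
  assumes deriv: "\<And>y. y \<in> cball x r \<Longrightarrow> (g has_derivative g' y) (at y)"
    and bound: "\<And>y. y \<in> cball x r \<Longrightarrow> \<bar>g' y v\<bar> \<le> C"
    and "0 < h" "norm (h *\<^sub>R v) \<le> r"
  shows "\<bar>(g (x + h *\<^sub>R v) - g x) / h\<bar> \<le> C"
proof -
  have mem: "x + t *\<^sub>R v \<in> cball x r" if "0 \<le> t" "t \<le> h" for t
  proof -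
    have "norm (t *\<^sub>R v) \<le> norm (h *\<^sub>R v)"
      using that by (auto intro: mult_right_mono)
    then show ?thesis using assms(4) by (simp add: dist_norm)
  qed
  have d: "((\<lambda>t. g (x + t *\<^sub>R v)) has_real_derivative g' (x + t *\<^sub>R v) v) (at t)" if "0 \<le> t" "t \<le> h" for t
    by (rule has_real_derivative_along_line[OF deriv[OF mem[OF that]]])
  obtain z where z: "0 < z" "z < h" "g (x + h *\<^sub>R v) - g (x + 0 *\<^sub>R v) = (h - 0) * g' (x + z *\<^sub>R v) v"
    using MVT2[of 0 h "\<lambda>t. g (x + t *\<^sub>R v)" "\<lambda>t. g' (x + t *\<^sub>R v) v"] d \<open>0 < h\<close> by blast
  then have "(g (x + h *\<^sub>R v) - g x) / h = g' (x + z *\<^sub>R v) v"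
    using \<open>0 < h\<close> by simp
  then show ?thesis using bound[OF mem[of z]] z by simp
qed

lemma indicator_polytope_eq_prod:
  "indicator (polytope_of d u a) x = (\<Prod>k<d. of_bool (0 \<le> label u a k x) :: real)"
  by (induction d) (auto simp: polytope_of_def indicator_def less_Suc_eq lessThan_Suc)

text \<open>
  The divergence theorem for the constant direction \<open>v\<close>.  Two hyperplanes carrying facets must not
  coincide, since otherwise their common facet would be counted twice.  The function \<open>g\<close> is used on a
  compact neighbourhood \<open>K\<close> of the polytope and extended by zero, so that it can be translated.
\<close>

theorem polytope_divergence:
  fixes g :: "real ^ 'n::finite \<Rightarrow> real" and g' :: "real ^ 'n \<Rightarrow> real ^ 'n \<Rightarrow> real"
  assumes cpt: "compact (polytope_of d u a)"
    and nz: "\<And>j. j < d \<Longrightarrow> u j \<noteq> 0"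
    and indep: "\<And>j k. j < d \<Longrightarrow> k < d \<Longrightarrow> k \<noteq> j \<Longrightarrow> \<exists>y. label u a j y = 0 \<and> label u a k y \<noteq> 0"
    and V: "open V" "polytope_of d u a \<subseteq> V"
    and deriv: "\<And>x. x \<in> V \<Longrightarrow> (g has_derivative g' x) (at x)"
    and cont: "continuous_on V (\<lambda>x. g' x v)"
  shows "polytope_integral d u a (\<lambda>x. g' x v)
    = - (\<Sum>j<d. (u j \<bullet> v) * set_lebesgue_integral (hyperplane_measure (u j) (a j)) (facet d u a j) g)"
proof -
  let ?\<Delta> = "polytope_of d u a"
  obtain \<epsilon> where \<epsilon>: "\<epsilon> > 0" "(\<Union>x\<in>?\<Delta>. cball x \<epsilon>) \<subseteq> V"
    using compact_subset_open_imp_cball_epsilon_subset[OF cpt V] by blast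
  define K where "K = (\<Union>x\<in>?\<Delta>. cball x \<epsilon>)"
  have K_eq: "K = (\<Union>x\<in>?\<Delta>. \<Union>y\<in>cball 0 \<epsilon>. {x + y})"
  proof -
    have "cball x \<epsilon> = (\<Union>y\<in>cball 0 \<epsilon>. {x + y})" for x :: "real ^ 'n"
      using image_add_cball[of x 0 \<epsilon>] by (simp add: UNION_singleton_eq_range)
    then show ?thesis unfolding K_def by (intro SUP_cong refl)
  qed
  have K: "compact K" unfolding K_eq by (intro compact_sums' cpt compact_cball)
  have KV: "K \<subseteq> V" using \<epsilon> by (simp add: K_def)
  have ballK: "cball x \<epsilon> \<subseteq> K" if "x \<in> ?\<Delta>" for x
    unfolding K_def using that by blast
  have \<Delta>K: "?\<Delta> \<subseteq> K" using ballK \<epsilon>(1) by (meson centre_in_cball less_imp_le subset_iff)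
  have gV: "continuous_on V g"
    using deriv by (meson has_derivative_at_withinI has_derivative_continuous_on)
  obtain M where M: "M \<ge> 0" "\<And>x. x \<in> K \<Longrightarrow> \<bar>g x\<bar> \<le> M"
    using continuous_on_compact_bound[OF K continuous_on_subset[OF gV KV]] by (metis real_norm_def)
  obtain C where C: "C \<ge> 0" "\<And>x. x \<in> K \<Longrightarrow> \<bar>g' x v\<bar> \<le> C"
    using continuous_on_compact_bound[OF K continuous_on_subset[OF cont KV]] by (metis real_norm_def)
  define G where "G = (\<lambda>x. indicator K x * g x)"
  have G[measurable]: "G \<in> borel_measurable borel"
    unfolding G_def using K gV KV
    by (intro indicator_mult_borel) (auto intro: compact_imp_closed continuous_on_subset)
  have GM: "\<bar>G x\<bar> \<le> M" for x using M by (auto simp: G_def indicator_def)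
  have GK: "G x = 0" if "x \<notin> K" for x using that by (simp add: G_def)
  define h where "h = (\<lambda>n. min 1 (\<epsilon> / (norm v + 1)) / real (Suc n))"
  have npos: "norm v + 1 > 0" by (simp add: add_nonneg_pos)
  have h: "h n > 0" "h n \<le> 1" "norm (h n *\<^sub>R v) \<le> \<epsilon>" for n
  proof -
    show hp: "h n > 0" using \<epsilon> npos by (simp add: h_def)
    have le: "h n \<le> min 1 (\<epsilon> / (norm v + 1))"
    proof -
      have "0 \<le> min 1 (\<epsilon> / (norm v + 1))" using \<epsilon> npos by simp
      then show ?thesis
        unfolding h_def using divide_left_mono[of 1 "real (Suc n)" "min 1 (\<epsilon> / (norm v + 1))"] by simp
    qed
    then show "h n \<le> 1" by simp
    have "norm (h n *\<^sub>R v) \<le> (\<epsilon> / (norm v + 1)) * norm v"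
      unfolding norm_scaleR using hp le by (intro mult_right_mono) auto
    also have "\<dots> \<le> \<epsilon>"
      using \<epsilon> npos by (simp add: field_simps)
    finally show "norm (h n *\<^sub>R v) \<le> \<epsilon>" .
  qed
  have h0: "h \<longlonglongrightarrow> 0"
    unfolding h_def by (rule LIMSEQ_Suc[OF lim_const_over_n])
  have [measurable]: "?\<Delta> \<in> sets borel" by (intro borel_closed closed_polytope_of)
  have indI: "integrable lborel (indicator ?\<Delta> :: real ^ 'n \<Rightarrow> real)"
    using emeasure_bounded_finite[OF compact_imp_bounded[OF cpt]]
    by (intro integrable_real_indicator) auto
  have intG: "integrable lborel (\<lambda>x. G x * w x)"
    if [measurable]: "w \<in> borel_measurable borel" and "\<And>x. \<bar>w x\<bar> \<le> B" for w :: "real ^ 'n \<Rightarrow> real" and B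
  proof (rule integrable_bounded_support)
    show "bounded K" using K by (rule compact_imp_bounded)
    show "\<bar>G x * w x\<bar> \<le> M * B" for x
      unfolding abs_mult using GM M that(2) by (intro mult_mono) auto
  qed (use GK in auto)

  \<comment> \<open>The integrals I n are computed in two ways: their limit is the left-hand side by dominated
      convergence, and moving the translation onto the indicator gives the right-hand side.\<close>
  define I where "I = (\<lambda>n. \<integral>x. indicator ?\<Delta> x * ((G (x + h n *\<^sub>R v) - G x) / h n) \<partial>lborel)"

  have lim1: "I \<longlonglongrightarrow> polytope_integral d u a (\<lambda>x. g' x v)"
  proof -
    have "I \<longlonglongrightarrow> (\<integral>x. indicator ?\<Delta> x * g' x v \<partial>lborel)"
      unfolding I_def
    proof (rule integral_dominated_convergence)
      show "integrable lborel (\<lambda>x. indicator ?\<Delta> x * C)"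
        using indI by simp
      show "(\<lambda>x. indicator ?\<Delta> x * g' x v) \<in> borel_measurable lborel"
        using indicator_mult_borel[OF closed_polytope_of continuous_on_subset[OF cont V(2)]] by simp
      show "AE x in lborel. norm (indicator ?\<Delta> x * ((G (x + h n *\<^sub>R v) - G x) / h n)) \<le> indicator ?\<Delta> x * C" for n
      proof (rule AE_I2)
        fix x :: "real ^ 'n"
        show "norm (indicator ?\<Delta> x * ((G (x + h n *\<^sub>R v) - G x) / h n)) \<le> indicator ?\<Delta> x * C"
        proof (cases "x \<in> ?\<Delta>")
          case True
          have "x + h n *\<^sub>R v \<in> cball x \<epsilon>" using h[of n] by (simp add: dist_norm)
          then have "x + h n *\<^sub>R v \<in> K" "x \<in> K" using ballK[OF True] \<Delta>K True by auto
          then have "G (x + h n *\<^sub>R v) - G x = g (x + h n *\<^sub>R v) - g x"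
            by (simp add: G_def)
          moreover have "\<bar>(g (x + h n *\<^sub>R v) - g x) / h n\<bar> \<le> C"
            using ballK[OF True] KV C h[of n]
            by (intro difference_quotient_bound[of x \<epsilon> g g']) (auto intro!: deriv)
          ultimately show ?thesis using True by simp
        qed simp
      qed
      show "AE x in lborel. (\<lambda>n. indicator ?\<Delta> x * ((G (x + h n *\<^sub>R v) - G x) / h n)) \<longlonglongrightarrow> indicator ?\<Delta> x * g' x v"
      proof (rule AE_I2)
        fix x :: "real ^ 'n"
        show "(\<lambda>n. indicator ?\<Delta> x * ((G (x + h n *\<^sub>R v) - G x) / h n)) \<longlonglongrightarrow> indicator ?\<Delta> x * g' x v"
        proof (cases "x \<in> ?\<Delta>")
          case True
          have eq: "(G (x + h n *\<^sub>R v) - G x) / h n = (g (x + h n *\<^sub>R v) - g x) / h n" for n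
          proof -
            have "x + h n *\<^sub>R v \<in> cball x \<epsilon>" using h[of n] by (simp add: dist_norm)
            then have "x + h n *\<^sub>R v \<in> K" "x \<in> K" using ballK[OF True] \<Delta>K True by auto
            then show ?thesis by (simp add: G_def)
          qed
          have dx: "(g has_derivative g' x) (at (x + 0 *\<^sub>R v))"
            using deriv V(2) True by auto
          have "((\<lambda>t. g (x + t *\<^sub>R v)) has_real_derivative g' x v) (at 0)"
            by (rule has_real_derivative_along_line[OF dx])
          then have "((\<lambda>t. (g (x + t *\<^sub>R v) - g x) / t) \<longlongrightarrow> g' x v) (at 0)"
            by (simp add: has_field_derivative_iff)
          moreover have "filterlim h (at 0) sequentially"
            using h0 h(1) by (auto simp: filterlim_at intro!: eventuallyI less_imp_neq[symmetric])
          ultimately have "(\<lambda>n. (g (x + h n *\<^sub>R v) - g x) / h n) \<longlonglongrightarrow> g' x v"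
            by (rule filterlim_compose)
          then show ?thesis unfolding eq using True by simp
        qed simp
      qed
    qed measurable
    then show ?thesis by (simp add: polytope_integral_def set_lebesgue_integral_def)
  qed

  \<comment> \<open>In the j-th term of the telescoping sum, Q j n collects the indicators of the half-spaces
      other than the j-th one.\<close>
  define Q where "Q = (\<lambda>j n x. (\<Prod>k<j. of_bool (0 \<le> label u a k (x - h n *\<^sub>R v)))
      * (\<Prod>k\<in>{j<..<d}. of_bool (0 \<le> label u a k x)) :: real)"
  have [measurable]: "Q j n \<in> borel_measurable borel" for j n
    unfolding Q_def label_def by measurable
  have Q1: "0 \<le> Q j n x \<and> Q j n x \<le> 1" for j n x
    unfolding Q_def by (intro conjI mult_nonneg_nonneg mult_le_one prod_nonneg prod_le_1) auto
  define J where "J = (\<lambda>j n. \<integral>x. (G x * Q j n x)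
     * ((of_bool (h n * (u j \<bullet> v) \<le> u j \<bullet> x + a j) - of_bool (0 \<le> u j \<bullet> x + a j)) / h n) \<partial>lborel)"

  have IJ: "I n = (\<Sum>j<d. J j n)" for n
  proof -
    have trans: "(\<integral>x. indicator ?\<Delta> x * G (x + h n *\<^sub>R v) \<partial>lborel) = (\<integral>x. indicator ?\<Delta> (x - h n *\<^sub>R v) * G x \<partial>lborel)"
      by (subst lborel_distr_plus[of "- (h n *\<^sub>R v)", symmetric], subst integral_distr) (auto simp: algebra_simps)
    have i1: "integrable lborel (\<lambda>x. indicator ?\<Delta> (x - h n *\<^sub>R v) * G x)"
      using intG[of "\<lambda>x. indicator ?\<Delta> (x - h n *\<^sub>R v)" 1] by (simp add: mult.commute)
    have i2: "integrable lborel (\<lambda>x. indicator ?\<Delta> x * G x)"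
      using intG[of "indicator ?\<Delta>" 1] by (simp add: mult.commute)
    have i3: "integrable lborel (\<lambda>x. indicator ?\<Delta> x * G (x + h n *\<^sub>R v))"
    proof (rule integrable_bounded_support)
      show "bounded ?\<Delta>" using cpt by (rule compact_imp_bounded)
      show "\<bar>indicator ?\<Delta> x * G (x + h n *\<^sub>R v)\<bar> \<le> M" for x
        using GM M by (auto simp: indicator_def)
    qed auto
    have "I n = ((\<integral>x. indicator ?\<Delta> x * G (x + h n *\<^sub>R v) \<partial>lborel) - (\<integral>x. indicator ?\<Delta> x * G x \<partial>lborel)) / h n"
      unfolding I_def using i2 i3
      by (simp add: right_diff_distrib diff_divide_distrib)
    also have "\<dots> = (\<integral>x. G x * ((indicator ?\<Delta> (x - h n *\<^sub>R v) - indicator ?\<Delta> x) / h n) \<partial>lborel)"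
      unfolding trans using i1 i2
      by (simp add: right_diff_distrib diff_divide_distrib mult.commute)
    also have "\<dots> = (\<integral>x. (\<Sum>j<d. (G x * Q j n x)
     * ((of_bool (h n * (u j \<bullet> v) \<le> u j \<bullet> x + a j) - of_bool (0 \<le> u j \<bullet> x + a j)) / h n)) \<partial>lborel)"
    proof (rule Bochner_Integration.integral_cong[OF refl])
      fix x
      have sh: "0 \<le> label u a j (x - h n *\<^sub>R v) \<longleftrightarrow> h n * (u j \<bullet> v) \<le> u j \<bullet> x + a j" for j
        by (simp add: label_def inner_diff_right algebra_simps)
      have "indicator ?\<Delta> (x - h n *\<^sub>R v) - indicator ?\<Delta> x =
        (\<Sum>j<d. Q j n x * (of_bool (h n * (u j \<bullet> v) \<le> u j \<bullet> x + a j) - of_bool (0 \<le> u j \<bullet> x + a j)))"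
        unfolding indicator_polytope_eq_prod prod_telescope
        by (intro sum.cong) (simp_all add: Q_def flip: sh, simp add: label_def)
      then show "G x * ((indicator ?\<Delta> (x - h n *\<^sub>R v) - indicator ?\<Delta> x) / h n)
         = (\<Sum>j<d. (G x * Q j n x) * ((of_bool (h n * (u j \<bullet> v) \<le> u j \<bullet> x + a j) - of_bool (0 \<le> u j \<bullet> x + a j)) / h n))"
        by (simp add: sum_distrib_left sum_divide_distrib mult_ac)
    qed
    also have "\<dots> = (\<Sum>j<d. J j n)"
      unfolding J_def
    proof (rule Bochner_Integration.integral_sum)
      fix j
      have "integrable lborel (\<lambda>x. G x * (Q j n x * ((of_bool (h n * (u j \<bullet> v) \<le> u j \<bullet> x + a j) - of_bool (0 \<le> u j \<bullet> x + a j)) / h n)))"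
      proof (rule intG)
        fix x
        have "\<bar>Q j n x\<bar> * \<bar>(of_bool (h n * (u j \<bullet> v) \<le> u j \<bullet> x + a j) - of_bool (0 \<le> u j \<bullet> x + a j)) / h n\<bar> \<le> 1 * (1 / h n)"
          using Q1[of j n x] h(1)[of n] by (intro mult_mono) (auto simp: divide_right_mono)
        then show "\<bar>Q j n x * ((of_bool (h n * (u j \<bullet> v) \<le> u j \<bullet> x + a j) - of_bool (0 \<le> u j \<bullet> x + a j)) / h n)\<bar> \<le> 1 / h n"
          by (simp add: abs_mult)
      qed measurable
      then show "integrable lborel (\<lambda>x. (G x * Q j n x) * ((of_bool (h n * (u j \<bullet> v) \<le> u j \<bullet> x + a j) - of_bool (0 \<le> u j \<bullet> x + a j)) / h n))"
        by (simp add: mult.assoc)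
    qed
    finally show ?thesis .
  qed

  have limJ: "J j \<longlonglongrightarrow> - (u j \<bullet> v) * set_lebesgue_integral (hyperplane_measure (u j) (a j)) (facet d u a j) g"
    if j: "j < d" for j
  proof -
    have \<Phi>: "(\<lambda>y. indicator (facet d u a j) y * g y) \<in> borel_measurable borel"
      using facet_subset[of d u a j] V by (intro indicator_mult_borel closed_facet continuous_on_subset[OF gV]) auto
    have "J j \<longlonglongrightarrow> - (u j \<bullet> v) * (\<integral>z. indicator {0..1} (u j \<bullet> z + a j) *
        (indicator (facet d u a j) (slide (u j) (a j) 0 z) * g (slide (u j) (a j) 0 z)) \<partial>lborel)"
      unfolding J_def
    proof (rule slab_limit[OF nz[OF j] _ \<Phi> compact_imp_bounded[OF K]])
      show "(\<lambda>x. G x * Q j n x) \<in> borel_measurable borel" for n by measurable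
      show "\<bar>G x * Q j n x\<bar> \<le> M" for n x
        using mult_mono[OF GM, of "\<bar>Q j n x\<bar>" 1 x] Q1[of j n x] M by (simp add: abs_mult)
      show "G x * Q j n x = 0" if "x \<notin> K" for n x using GK that by simp
      show "AE z in lborel. (\<lambda>n. G (slide (u j) (a j) (h n * (u j \<bullet> v)) z) * Q j n (slide (u j) (a j) (h n * (u j \<bullet> v)) z))
         \<longlonglongrightarrow> indicator (facet d u a j) (slide (u j) (a j) 0 z) * g (slide (u j) (a j) 0 z)"
      proof -
        \<comment> \<open>Away from the other hyperplanes, the indicators of their half-spaces are locally constant.\<close>
        have "AE z in lborel. \<forall>k\<in>{..<d} - {j}. label u a k (slide (u j) (a j) 0 z) \<noteq> 0"
        proof (rule AE_finite_allI)
          fix k assume "k \<in> {..<d} - {j}"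
          then obtain y where "label u a j y = 0" "label u a k y \<noteq> 0"
            using indep[OF j, of k] by auto
          then show "AE z in lborel. label u a k (slide (u j) (a j) 0 z) \<noteq> 0"
            unfolding label_def by (rule AE_slide_hyperplane)
        qed simp
        then show ?thesis
        proof eventually_elim
          case (elim z)
          define y where "y = slide (u j) (a j) 0 z"
          define x where "x = (\<lambda>n. slide (u j) (a j) (h n * (u j \<bullet> v)) z)"
          have Lj: "label u a j y = 0"
            using level_slide[OF nz[OF j], of "a j" 0 z] by (simp add: y_def label_def)
          have xy: "x \<longlonglongrightarrow> y"
          proof -
            have "x \<longlonglongrightarrow> z - ((1 - 0 * (u j \<bullet> v)) * (u j \<bullet> z + a j) / (u j \<bullet> u j)) *\<^sub>R u j"
              unfolding x_def slide_def using nz[OF j] by (intro tendsto_intros h0) auto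
            then show ?thesis by (simp add: y_def slide_def)
          qed
          have xy': "(\<lambda>n. x n - h n *\<^sub>R v) \<longlonglongrightarrow> y"
            using tendsto_diff[OF xy tendsto_scaleR[OF h0 tendsto_const[of v]]] by simp
          have lab: "(\<lambda>n. label u a k (w n)) \<longlonglongrightarrow> label u a k y" if "w \<longlonglongrightarrow> y" for w k
            unfolding label_def by (intro tendsto_intros that)
          have Qlim: "(\<lambda>n. Q j n (x n)) \<longlonglongrightarrow> (\<Prod>k<j. of_bool (0 \<le> label u a k y)) * (\<Prod>k\<in>{j<..<d}. of_bool (0 \<le> label u a k y))"
            unfolding Q_def using elim j
            by (intro tendsto_mult tendsto_prod tendsto_of_bool_nonneg lab xy xy') (auto simp: y_def)
          have prod_eq: "(\<Prod>k<j. of_bool (0 \<le> label u a k y)) * (\<Prod>k\<in>{j<..<d}. of_bool (0 \<le> label u a k y))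
             = (indicator (facet d u a j) y :: real)"
          proof -
            have "{..<d} = {..<j} \<union> ({j} \<union> {j<..<d})" using j by auto
            then have "indicator ?\<Delta> y = (\<Prod>k\<in>{..<j} \<union> ({j} \<union> {j<..<d}). of_bool (0 \<le> label u a k y) :: real)"
              by (simp add: indicator_polytope_eq_prod)
            also have "\<dots> = (\<Prod>k<j. of_bool (0 \<le> label u a k y)) * (\<Prod>k\<in>{j<..<d}. of_bool (0 \<le> label u a k y))"
              using Lj by (subst prod.union_disjoint) (auto simp: prod.union_disjoint)
            finally show ?thesis using Lj by (simp add: facet_def indicator_def)
          qed
          have "(\<lambda>n. G (x n) * Q j n (x n)) \<longlonglongrightarrow> indicator (facet d u a j) y * g y"
          proof (cases "y \<in> facet d u a j")
            case True
            then have y\<Delta>: "y \<in> ?\<Delta>" using facet_subset by blast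
            have "eventually (\<lambda>n. x n \<in> ball y \<epsilon>) sequentially"
              using xy \<epsilon> by (simp add: tendsto_iff dist_commute)
            then have "eventually (\<lambda>n. G (x n) = g (x n)) sequentially"
            proof eventually_elim
              case (elim n)
              then have "x n \<in> K" using ballK[OF y\<Delta>] by force
              then show ?case by (simp add: G_def)
            qed
            moreover have "(\<lambda>n. g (x n)) \<longlonglongrightarrow> g y"
            proof -
              have "isCont g y"
                using has_derivative_continuous[OF deriv] y\<Delta> V(2) by auto
              then show ?thesis by (rule isCont_tendsto_compose[OF _ xy])
            qed
            ultimately have "(\<lambda>n. G (x n)) \<longlonglongrightarrow> g y"
              by (simp add: tendsto_cong)
            from tendsto_mult[OF this Qlim] show ?thesis
              by (simp add: prod_eq mult.commute)
          next
            case False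
            then have Q0: "(\<lambda>n. M * Q j n (x n)) \<longlonglongrightarrow> 0"
              using tendsto_mult_left[OF Qlim, of M] by (simp add: prod_eq)
            have "(\<lambda>n. G (x n) * Q j n (x n)) \<longlonglongrightarrow> 0"
              by (rule Lim_null_comparison[OF _ Q0])
                 (use GM Q1 in \<open>auto simp: abs_mult intro!: mult_right_mono eventuallyI\<close>)
            then show ?thesis using False by simp
          qed
          then show ?case by (simp add: x_def y_def)
        qed
      qed
    qed (use h in auto)
    then show ?thesis by (simp add: set_integral_hyperplane_measure[OF \<Phi>])
  qed
  have "I \<longlonglongrightarrow> (\<Sum>j<d. - (u j \<bullet> v) * set_lebesgue_integral (hyperplane_measure (u j) (a j)) (facet d u a j) g)"
    unfolding IJ[abs_def] using limJ by (intro tendsto_sum) auto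
  from LIMSEQ_unique[OF lim1 this] show ?thesis
    by (simp add: sum_negf)
qed

section \<open>Functions of class \<open>C\<^sup>k\<close>\<close>

lemma partial_eq:
  "(g has_derivative D) (at x) \<Longrightarrow> partial i g x = D (axis i 1)"
  unfolding partial_def using frechet_derivative_at by metis

text \<open>
  The two functions have the same derivatives at \<open>x\<close>, from which \<open>frechet_derivative\<close> chooses one;
  if there are none, the choice still agrees.  Thus an equation between iterated partial derivatives
  can be transported along an equality on an open set.
\<close>

lemma partial_cong:
  assumes "open S" "x \<in> S" "\<And>y. y \<in> S \<Longrightarrow> g y = h y"
  shows "partial i g x = partial i h x"
proof -
  have "(g has_derivative D) (at x) \<longleftrightarrow> (h has_derivative D) (at x)" for D
    using assms has_derivative_transform_within_open by metis
  then show ?thesis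
    by (simp add: partial_def frechet_derivative_def)
qed

lemma Ck_on_cong:
  assumes "open S" "\<And>y. y \<in> S \<Longrightarrow> g y = h y" "Ck_on k S g"
  shows "Ck_on k S h"
  using assms(2,3)
proof (induction k arbitrary: g h)
  case 0
  then show ?case by (simp cong: continuous_on_cong)
next
  case (Suc k)
  have "h differentiable (at x)" if "x \<in> S" for x
    using Suc.prems that \<open>open S\<close>
    by (meson Ck_on.simps(2) differentiable_def has_derivative_transform_within_open)
  moreover have "Ck_on k S (partial i h)" for i
    using Suc.IH[of "partial i g" "partial i h"] Suc.prems partial_cong[OF \<open>open S\<close>, of _ g h i] by simp
  ultimately show ?case by simp
qed

lemma Ck_on_subset: "Ck_on k S g \<Longrightarrow> T \<subseteq> S \<Longrightarrow> Ck_on k T g"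
  by (induction k arbitrary: g) (auto intro: continuous_on_subset)

lemma Ck_on_SucD: "Ck_on (Suc k) S g \<Longrightarrow> Ck_on k S g"
proof (induction k arbitrary: g)
  case 0
  then show ?case
    by (auto intro!: differentiable_imp_continuous_on simp: differentiable_on_def differentiable_at_withinI)
next
  case (Suc k)
  then show ?case by (metis Ck_on.simps(2))
qed

lemma Ck_on_Suc_has_derivative:
  "Ck_on (Suc k) S g \<Longrightarrow> x \<in> S \<Longrightarrow> (g has_derivative frechet_derivative g (at x)) (at x)"
  by (simp add: frechet_derivative_works)

lemma Ck_on_imp_continuous_on: "Ck_on k S g \<Longrightarrow> continuous_on S g"
proof (cases k)
  case (Suc l)
  assume "Ck_on k S g"
  then have "\<And>x. x \<in> S \<Longrightarrow> g differentiable (at x)" by (simp add: Suc)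
  then show ?thesis
    by (auto intro!: differentiable_imp_continuous_on simp: differentiable_on_def differentiable_at_withinI)
qed simp

lemma partial_const [simp]: "partial i (\<lambda>x. c) x = 0"
  by (simp add: partial_def)

lemma Ck_on_const: "Ck_on k S (\<lambda>x. c)"
proof (induction k arbitrary: c)
  case (Suc k)
  have "partial i (\<lambda>x. c) = (\<lambda>x. 0)" for i :: 'a
    by (simp add: fun_eq_iff)
  then show ?case using Suc by simp
qed simp

lemma partial_add:
  assumes "f differentiable (at x)" "g differentiable (at x)"
  shows "partial i (\<lambda>x. f x + g x) x = partial i f x + partial i g x"
proof -
  have "((\<lambda>x. f x + g x) has_derivative
      (\<lambda>h. frechet_derivative f (at x) h + frechet_derivative g (at x) h)) (at x)"
    using assms by (intro has_derivative_add) (simp_all add: frechet_derivative_works)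
  from partial_eq[OF this] show ?thesis by (simp add: partial_def)
qed

lemma partial_diff:
  assumes "f differentiable (at x)" "g differentiable (at x)"
  shows "partial i (\<lambda>x. f x - g x) x = partial i f x - partial i g x"
proof -
  have "((\<lambda>x. f x - g x) has_derivative
      (\<lambda>h. frechet_derivative f (at x) h - frechet_derivative g (at x) h)) (at x)"
    using assms by (intro has_derivative_diff) (simp_all add: frechet_derivative_works)
  from partial_eq[OF this] show ?thesis by (simp add: partial_def)
qed

lemma partial_mult:
  fixes f g :: "real ^ 'n::finite \<Rightarrow> real"
  assumes "f differentiable (at x)" "g differentiable (at x)"
  shows "partial i (\<lambda>x. f x * g x) x = f x * partial i g x + partial i f x * g x"
proof -
  have "((\<lambda>x. f x * g x) has_derivative
      (\<lambda>h. f x * frechet_derivative g (at x) h + frechet_derivative f (at x) h * g x)) (at x)"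
    using assms by (intro has_derivative_mult) (simp_all add: frechet_derivative_works)
  from partial_eq[OF this] show ?thesis by (simp add: partial_def)
qed

lemma partial_sum:
  assumes "\<And>j. j \<in> A \<Longrightarrow> f j differentiable (at x)"
  shows "partial i (\<lambda>x. \<Sum>j\<in>A. f j x) x = (\<Sum>j\<in>A. partial i (f j) x)"
proof -
  have "((\<lambda>x. \<Sum>j\<in>A. f j x) has_derivative (\<lambda>h. \<Sum>j\<in>A. frechet_derivative (f j) (at x) h)) (at x)"
    using assms by (intro has_derivative_sum) (simp_all add: frechet_derivative_works)
  from partial_eq[OF this] show ?thesis by (simp add: partial_def)
qed

lemma partial_bounded_linear:
  assumes "bounded_linear T" "f differentiable (at x)"
  shows "partial i (\<lambda>x. T (f x)) x = T (partial i f x)"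
proof -
  have "((\<lambda>x. T (f x)) has_derivative (\<lambda>h. T (frechet_derivative f (at x) h))) (at x)"
    using assms(2) by (intro bounded_linear.has_derivative[OF assms(1)]) (simp add: frechet_derivative_works)
  from partial_eq[OF this] show ?thesis by (simp add: partial_def)
qed

lemma Ck_on_add:
  assumes "open S" "Ck_on k S f" "Ck_on k S g"
  shows "Ck_on k S (\<lambda>x. f x + g x)"
  using assms(2,3)
proof (induction k arbitrary: f g)
  case 0
  then show ?case by (auto intro: continuous_on_add)
next
  case (Suc k)
  have "Ck_on k S (partial i (\<lambda>x. f x + g x))" for i
  proof (rule Ck_on_cong[OF \<open>open S\<close>])
    show "Ck_on k S (\<lambda>x. partial i f x + partial i g x)"
      using Suc.prems by (intro Suc.IH) simp_all
    show "partial i f y + partial i g y = partial i (\<lambda>x. f x + g x) y" if "y \<in> S" for y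
      using Suc.prems that by (simp add: partial_add)
  qed
  with Suc.prems show ?case by simp
qed

lemma Ck_on_bounded_linear:
  assumes "open S" "bounded_linear T" "Ck_on k S f"
  shows "Ck_on k S (\<lambda>x. T (f x))"
  using assms(3)
proof (induction k arbitrary: f)
  case 0
  then show ?case using bounded_linear.continuous_on[OF assms(2)] by simp
next
  case (Suc k)
  have "Ck_on k S (partial i (\<lambda>x. T (f x)))" for i
  proof (rule Ck_on_cong[OF \<open>open S\<close>])
    show "Ck_on k S (\<lambda>x. T (partial i f x))"
      using Suc.prems by (intro Suc.IH) simp_all
    show "T (partial i f y) = partial i (\<lambda>x. T (f x)) y" if "y \<in> S" for y
      using Suc.prems that assms(2) by (simp add: partial_bounded_linear)
  qed
  moreover have "(\<lambda>x. T (f x)) differentiable (at x)" if "x \<in> S" for x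
    using bounded_linear.has_derivative[OF assms(2) Ck_on_Suc_has_derivative[OF Suc.prems that]]
    by (rule differentiableI)
  ultimately show ?case by simp
qed

lemma Ck_on_mult:
  fixes f g :: "real ^ 'n::finite \<Rightarrow> real"
  assumes "open S" "Ck_on k S f" "Ck_on k S g"
  shows "Ck_on k S (\<lambda>x. f x * g x)"
  using assms(2,3)
proof (induction k arbitrary: f g)
  case 0
  then show ?case by (auto intro: continuous_on_mult)
next
  case (Suc k)
  have "Ck_on k S (partial i (\<lambda>x. f x * g x))" for i
  proof (rule Ck_on_cong[OF \<open>open S\<close>])
    show "Ck_on k S (\<lambda>x. f x * partial i g x + partial i f x * g x)"
      using Suc.prems Ck_on_SucD[OF Suc.prems(1)] Ck_on_SucD[OF Suc.prems(2)]
      by (intro Ck_on_add[OF \<open>open S\<close>] Suc.IH) simp_all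
    show "f y * partial i g y + partial i f y * g y = partial i (\<lambda>x. f x * g x) y" if "y \<in> S" for y
      using Suc.prems that by (simp add: partial_mult)
  qed
  with Suc.prems show ?case by simp
qed

lemma Ck_on_sum:
  assumes "open S" "\<And>j. j \<in> A \<Longrightarrow> Ck_on k S (f j)"
  shows "Ck_on k S (\<lambda>x. \<Sum>j\<in>A. f j x)"
  using assms(2)
proof (induction A rule: infinite_finite_induct)
  case (insert j A)
  have "Ck_on k S (\<lambda>x. f j x + (\<Sum>j\<in>A. f j x))"
    by (rule Ck_on_add[OF \<open>open S\<close>]) (simp_all add: insert)
  with insert.hyps show ?case by simp
qed (simp_all add: Ck_on_const)

lemma Ck_on_minus:
  fixes f :: "real ^ 'n::finite \<Rightarrow> 'b::real_normed_vector"
  assumes "open S" "Ck_on k S f"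
  shows "Ck_on k S (\<lambda>x. - f x)"
  by (rule Ck_on_bounded_linear[OF assms(1) _ assms(2)]) (rule bounded_linear_minus[OF bounded_linear_ident])

lemma Ck_on_diff:
  assumes "open S" "Ck_on k S f" "Ck_on k S g"
  shows "Ck_on k S (\<lambda>x. f x - g x)"
  using Ck_on_add[OF assms(1,2) Ck_on_minus[OF assms(1,3)]] by simp

lemma Ck_on_inverse:
  fixes f :: "real ^ 'n::finite \<Rightarrow> real"
  assumes "open S" "Ck_on k S f" and nz: "\<And>x. x \<in> S \<Longrightarrow> f x \<noteq> 0"
  shows "Ck_on k S (\<lambda>x. inverse (f x))"
  using assms(2)
proof (induction k)
  case 0
  then show ?case using nz by (auto intro: continuous_on_inverse)
next
  case (Suc k)
  have inv: "((\<lambda>x. inverse (f x)) has_derivative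
      (\<lambda>h. - (inverse (f x) * frechet_derivative f (at x) h * inverse (f x)))) (at x)" if "x \<in> S" for x
    by (rule Deriv.has_derivative_inverse[OF nz[OF that] Ck_on_Suc_has_derivative[OF Suc.prems that]])
  have IH: "Ck_on k S (\<lambda>x. inverse (f x))"
    by (rule Suc.IH[OF Ck_on_SucD[OF Suc.prems]])
  have "Ck_on k S (partial i (\<lambda>x. inverse (f x)))" for i
  proof (rule Ck_on_cong[OF \<open>open S\<close>])
    show "Ck_on k S (\<lambda>x. - (inverse (f x) * partial i f x * inverse (f x)))"
      by (rule Ck_on_minus[OF \<open>open S\<close> Ck_on_mult[OF \<open>open S\<close> Ck_on_mult[OF \<open>open S\<close> IH] IH]])
         (use Suc.prems in simp)
    show "- (inverse (f y) * partial i f y * inverse (f y)) = partial i (\<lambda>x. inverse (f x)) y" if "y \<in> S" for y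
      using partial_eq[OF inv[OF that]] by (simp add: partial_def)
  qed
  moreover have "(\<lambda>x. inverse (f x)) differentiable (at x)" if "x \<in> S" for x
    using inv[OF that] by (rule differentiableI)
  ultimately show ?case by simp
qed

lemma Ck_on_power:
  fixes f :: "real ^ 'n::finite \<Rightarrow> real"
  assumes "open S" "Ck_on k S f"
  shows "Ck_on k S (\<lambda>x. f x ^ n)"
proof (induction n)
  case (Suc n)
  show ?case
    unfolding power_Suc by (rule Ck_on_mult[OF assms Suc])
qed (simp add: Ck_on_const)

lemma Ck_on_inner: "Ck_on k S (\<lambda>x. v \<bullet> x)"
proof (cases k)
  case (Suc l)
  have d: "((\<lambda>x. v \<bullet> x) has_derivative (\<lambda>h. v \<bullet> h)) (at x)" for x
    by (auto intro!: derivative_eq_intros)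
  have "partial i (\<lambda>x. v \<bullet> x) = (\<lambda>x. v \<bullet> axis i 1)" for i
    using partial_eq[OF d] by (simp add: fun_eq_iff)
  moreover have "(\<lambda>x. v \<bullet> x) differentiable (at x)" for x
    using d by (rule differentiableI)
  ultimately show ?thesis by (simp add: Suc Ck_on_const)
qed (simp add: continuous_on_inner continuous_on_const continuous_on_id)

lemma Ck_on_affine: "Ck_on k S (\<lambda>x. v \<bullet> x + b)"
proof -
  have "Ck_on k UNIV (\<lambda>x. v \<bullet> x + b)"
    by (rule Ck_on_add[OF open_UNIV Ck_on_inner Ck_on_const])
  then show ?thesis by (rule Ck_on_subset) simp
qed

lemma derivative_eq_sum_partial:
  fixes g :: "real ^ 'n::finite \<Rightarrow> 'b::real_normed_vector"
  assumes "(g has_derivative D) (at x)"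
  shows "D v = (\<Sum>i\<in>UNIV. v $ i *\<^sub>R partial i g x)"
proof -
  have lin: "linear D" using assms by (rule has_derivative_linear)
  have "D v = D (\<Sum>i\<in>UNIV. v $ i *\<^sub>R axis i 1)"
    using basis_expansion[of v] by (simp add: scalar_mult_eq_scaleR)
  also have "\<dots> = (\<Sum>i\<in>UNIV. v $ i *\<^sub>R partial i g x)"
    by (simp add: linear_sum[OF lin] linear_cmul[OF lin] partial_eq[OF assms])
  finally show ?thesis .
qed

text \<open>
  The mean value theorem, applied once in each of the two directions.
\<close>

lemma second_difference_eq_partial:
  fixes g :: "real ^ 'n::finite \<Rightarrow> real"
  assumes C2: "Ck_on 2 (ball x r) g" and t: "0 < t" "2 * t < r"
  obtains p where "dist p x \<le> 2 * t"
    "g (x + t *\<^sub>R axis i 1 + t *\<^sub>R axis j 1) - g (x + t *\<^sub>R axis i 1) - g (x + t *\<^sub>R axis j 1) + g x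
      = t\<^sup>2 * partial j (partial i g) p"
proof -
  let ?a = "axis i 1 :: real ^ 'n" and ?b = "axis j 1 :: real ^ 'n"
  have near: "dist (x + s *\<^sub>R ?a + s' *\<^sub>R ?b) x \<le> 2 * t" if "0 \<le> s" "s \<le> t" "0 \<le> s'" "s' \<le> t" for s s'
  proof -
    have "norm (s *\<^sub>R ?a + s' *\<^sub>R ?b) \<le> norm (s *\<^sub>R ?a) + norm (s' *\<^sub>R ?b)"
      by (rule norm_triangle_ineq)
    then show ?thesis using that by (simp add: dist_norm norm_axis_1 add.assoc)
  qed
  have inb: "x + s *\<^sub>R ?a + s' *\<^sub>R ?b \<in> ball x r" if "0 \<le> s" "s \<le> t" "0 \<le> s'" "s' \<le> t" for s s'
    using near[OF that] t by (simp add: dist_commute)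
  have C2': "Ck_on (Suc (Suc 0)) (ball x r) g" using C2 by (simp add: numeral_2_eq_2)
  have C1: "Ck_on (Suc 0) (ball x r) (partial i g)"
    using C2' by simp
  have d1: "((\<lambda>s. g (x + s *\<^sub>R ?a + c *\<^sub>R ?b)) has_real_derivative partial i g (x + s *\<^sub>R ?a + c *\<^sub>R ?b)) (at s)"
    if "0 \<le> s" "s \<le> t" "0 \<le> c" "c \<le> t" for s c
  proof -
    have l: "((\<lambda>s. x + s *\<^sub>R ?a + c *\<^sub>R ?b) has_derivative (\<lambda>h. h *\<^sub>R ?a)) (at s)"
      by (auto intro!: derivative_eq_intros)
    note D = Ck_on_Suc_has_derivative[OF C2' inb[OF that]]
    have "((\<lambda>s. g (x + s *\<^sub>R ?a + c *\<^sub>R ?b)) has_derivative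
       (\<lambda>h. frechet_derivative g (at (x + s *\<^sub>R ?a + c *\<^sub>R ?b)) (h *\<^sub>R ?a))) (at s)"
      using has_derivative_compose[OF l, of g] D by simp
    then show ?thesis
      by (simp add: has_field_derivative_def linear_cmul[OF has_derivative_linear[OF D]] partial_def mult_commute_abs)
  qed
  have d2: "((\<lambda>s'. partial i g (x + c *\<^sub>R ?a + s' *\<^sub>R ?b)) has_real_derivative partial j (partial i g) (x + c *\<^sub>R ?a + s' *\<^sub>R ?b)) (at s')"
    if "0 \<le> c" "c \<le> t" "0 \<le> s'" "s' \<le> t" for s' c
  proof -
    have l: "((\<lambda>s'. x + c *\<^sub>R ?a + s' *\<^sub>R ?b) has_derivative (\<lambda>h. h *\<^sub>R ?b)) (at s')"
      by (auto intro!: derivative_eq_intros)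
    note D = Ck_on_Suc_has_derivative[OF C1 inb[OF that]]
    have "((\<lambda>s'. partial i g (x + c *\<^sub>R ?a + s' *\<^sub>R ?b)) has_derivative
       (\<lambda>h. frechet_derivative (partial i g) (at (x + c *\<^sub>R ?a + s' *\<^sub>R ?b)) (h *\<^sub>R ?b))) (at s')"
      using has_derivative_compose[OF l, of "partial i g"] D by simp
    then show ?thesis
      by (simp add: has_field_derivative_def linear_cmul[OF has_derivative_linear[OF D]] partial_def mult_commute_abs)
  qed
  have "\<exists>z. 0 < z \<and> z < t \<and> (g (x + t *\<^sub>R ?a + t *\<^sub>R ?b) - g (x + t *\<^sub>R ?a + 0 *\<^sub>R ?b))
        - (g (x + 0 *\<^sub>R ?a + t *\<^sub>R ?b) - g (x + 0 *\<^sub>R ?a + 0 *\<^sub>R ?b))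
      = (t - 0) * (partial i g (x + z *\<^sub>R ?a + t *\<^sub>R ?b) - partial i g (x + z *\<^sub>R ?a + 0 *\<^sub>R ?b))"
    using t by (intro MVT2[of 0 t "\<lambda>s. g (x + s *\<^sub>R ?a + t *\<^sub>R ?b) - g (x + s *\<^sub>R ?a + 0 *\<^sub>R ?b)"] DERIV_diff d1) auto
  then obtain z where z: "0 < z" "z < t"
     "(g (x + t *\<^sub>R ?a + t *\<^sub>R ?b) - g (x + t *\<^sub>R ?a + 0 *\<^sub>R ?b))
        - (g (x + 0 *\<^sub>R ?a + t *\<^sub>R ?b) - g (x + 0 *\<^sub>R ?a + 0 *\<^sub>R ?b))
      = (t - 0) * (partial i g (x + z *\<^sub>R ?a + t *\<^sub>R ?b) - partial i g (x + z *\<^sub>R ?a + 0 *\<^sub>R ?b))"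
    by blast
  have "\<exists>w. 0 < w \<and> w < t \<and> partial i g (x + z *\<^sub>R ?a + t *\<^sub>R ?b) - partial i g (x + z *\<^sub>R ?a + 0 *\<^sub>R ?b)
      = (t - 0) * partial j (partial i g) (x + z *\<^sub>R ?a + w *\<^sub>R ?b)"
    using t z(1,2) by (intro MVT2 d2) auto
  then obtain w where w: "0 < w" "w < t" "partial i g (x + z *\<^sub>R ?a + t *\<^sub>R ?b) - partial i g (x + z *\<^sub>R ?a + 0 *\<^sub>R ?b)
      = (t - 0) * partial j (partial i g) (x + z *\<^sub>R ?a + w *\<^sub>R ?b)"
    by blast
  show ?thesis
  proof (rule that[of "x + z *\<^sub>R ?a + w *\<^sub>R ?b"])
    show "dist (x + z *\<^sub>R ?a + w *\<^sub>R ?b) x \<le> 2 * t" using z w by (intro near) auto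
    show "g (x + t *\<^sub>R ?a + t *\<^sub>R ?b) - g (x + t *\<^sub>R ?a) - g (x + t *\<^sub>R ?b) + g x
      = t\<^sup>2 * partial j (partial i g) (x + z *\<^sub>R ?a + w *\<^sub>R ?b)"
      using z(3) unfolding w(3) by (simp add: power2_eq_square algebra_simps)
  qed
qed

text \<open>
  The second difference of \<open>g\<close> is symmetric in the two directions, so the two mixed partial derivatives
  agree at suitable points arbitrarily close to \<open>x\<close>.
\<close>

theorem partial_commute:
  fixes g :: "real ^ 'n::finite \<Rightarrow> real"
  assumes S: "open S" "x \<in> S" and C2: "Ck_on 2 S g"
  shows "partial j (partial i g) x = partial i (partial j g) x"
proof -
  obtain r where r: "r > 0" "ball x r \<subseteq> S"
    using S open_contains_ball by blast
  define t where "t = (\<lambda>n. (r / 4) / real (Suc n))"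
  have t: "0 < t n" "2 * t n < r" for n
  proof -
    show "0 < t n" using r by (simp add: t_def)
    have "t n \<le> r / 4" unfolding t_def using r divide_left_mono[of 1 "real (Suc n)" "r / 4"] by simp
    then show "2 * t n < r" using r by simp
  qed
  have t0: "t \<longlonglongrightarrow> 0"
    unfolding t_def by (rule LIMSEQ_Suc[OF lim_const_over_n])
  have C2r: "Ck_on 2 (ball x r) g" using C2 r(2) by (rule Ck_on_subset)
  have "\<exists>p q. dist p x \<le> 2 * t n \<and> dist q x \<le> 2 * t n \<and> partial j (partial i g) p = partial i (partial j g) q" for n
  proof -
    obtain p where p: "dist p x \<le> 2 * t n" "g (x + t n *\<^sub>R axis i 1 + t n *\<^sub>R axis j 1) - g (x + t n *\<^sub>R axis i 1) - g (x + t n *\<^sub>R axis j 1) + g x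
      = (t n)\<^sup>2 * partial j (partial i g) p"
      using second_difference_eq_partial[OF C2r t] by blast
    obtain q where q: "dist q x \<le> 2 * t n" "g (x + t n *\<^sub>R axis j 1 + t n *\<^sub>R axis i 1) - g (x + t n *\<^sub>R axis j 1) - g (x + t n *\<^sub>R axis i 1) + g x
      = (t n)\<^sup>2 * partial i (partial j g) q"
      using second_difference_eq_partial[OF C2r t] by blast
    have "(t n)\<^sup>2 * partial j (partial i g) p = (t n)\<^sup>2 * partial i (partial j g) q"
      using p(2) q(2) by (simp add: algebra_simps)
    then show ?thesis using p(1) q(1) t(1)[of n] by auto
  qed
  then obtain p q where pq: "\<And>n. dist (p n) x \<le> 2 * t n" "\<And>n. dist (q n) x \<le> 2 * t n"
      "\<And>n. partial j (partial i g) (p n) = partial i (partial j g) (q n)"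
    by metis
  have lim: "w \<longlonglongrightarrow> x" if "\<And>n. dist (w n) x \<le> 2 * t n" for w :: "nat \<Rightarrow> real ^ 'n"
  proof -
    have "(\<lambda>n. dist (w n) x) \<longlonglongrightarrow> 0"
      by (rule Lim_null_comparison[of _ "\<lambda>n. 2 * t n"])
         (use that tendsto_mult_left[OF t0, of 2] in auto)
    then show ?thesis using tendsto_dist_iff by blast
  qed
  have cont: "isCont (partial l (partial k g)) x" for l k
  proof -
    have "Ck_on 0 S (partial l (partial k g))" using C2 by (simp add: numeral_2_eq_2)
    then show ?thesis using S by (simp add: continuous_on_eq_continuous_at)
  qed
  have "(\<lambda>n. partial j (partial i g) (p n)) \<longlonglongrightarrow> partial j (partial i g) x"
    by (rule isCont_tendsto_compose[OF cont lim]) (rule pq)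
  moreover have "(\<lambda>n. partial i (partial j g) (q n)) \<longlonglongrightarrow> partial i (partial j g) x"
    by (rule isCont_tendsto_compose[OF cont lim]) (rule pq)
  ultimately show ?thesis
    unfolding pq(3) by (rule LIMSEQ_unique)
qed

section \<open>Positive definite and semidefinite matrices\<close>

lemma inner_symmetric_matrix:
  fixes A :: "real ^ 'n::finite ^ 'n"
  assumes "transpose A = A"
  shows "x \<bullet> (A *v y) = y \<bullet> (A *v x)"
  using dot_lmul_matrix[of x A y] transpose_matrix_vector[of A x] assms
  by (simp add: inner_commute)

lemma quadratic_form_add:
  fixes A :: "real ^ 'n::finite ^ 'n"
  assumes "transpose A = A"
  shows "(v + t *\<^sub>R e) \<bullet> (A *v (v + t *\<^sub>R e)) = v \<bullet> (A *v v) + 2 * t * (v \<bullet> (A *v e)) + t\<^sup>2 * (e \<bullet> (A *v e))"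
  using inner_symmetric_matrix[OF assms, of v e]
  by (simp add: matrix_vector_right_distrib matrix_vector_mult_scaleR inner_add_left inner_add_right
      power2_eq_square algebra_simps)

lemma matrix_axis_component: "(A *v axis s 1) $ i = (A :: real ^ 'n::finite ^ 'n) $ i $ s"
  by (simp add: matrix_vector_mult_basis column_def)

lemma outer_mult_vec:
  fixes w :: "real ^ 'n::finite"
  shows "(\<chi> i j. w $ i * w $ j) *v v = (w \<bullet> v) *\<^sub>R w"
  by (simp add: vec_eq_iff matrix_vector_mult_def inner_vec_def sum_distrib_left sum_distrib_right mult_ac)

lemma sum_outer_eq_quadratic_form:
  fixes w :: "real ^ 'n::finite"
  shows "(\<Sum>i\<in>UNIV. \<Sum>j\<in>UNIV. (w $ i * w $ j) * B $ i $ j) = w \<bullet> (B *v w)"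
  by (simp add: matrix_vector_mult_def inner_vec_def sum_distrib_left mult_ac)

text \<open>
  If \<open>A\<close> is a sum of matrices \<open>w w\<^sup>T\<close>, the sum is a sum of values \<open>w \<bullet> B w\<close>.  Such a decomposition is
  found by completing squares: subtracting \<open>w w\<^sup>T / A\<^sub>s\<^sub>s\<close>, with \<open>w\<close> the column \<open>s\<close> of \<open>A\<close>, leaves a
  semidefinite matrix whose row and column \<open>s\<close> vanish.  The induction is on a set \<open>S\<close> of indices outside
  of which \<open>A\<close> is zero.
\<close>

theorem sum_mult_psd_nonneg:
  fixes A B :: "real ^ 'n::finite ^ 'n"
  assumes "transpose A = A" "\<And>v. 0 \<le> v \<bullet> (A *v v)" and B: "\<And>v. 0 \<le> v \<bullet> (B *v v)"
  shows "0 \<le> (\<Sum>i\<in>UNIV. \<Sum>j\<in>UNIV. A $ i $ j * B $ i $ j)"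
proof -
  have "0 \<le> (\<Sum>i\<in>UNIV. \<Sum>j\<in>UNIV. A $ i $ j * B $ i $ j)"
    if "finite S" "transpose A = A" "\<And>v. 0 \<le> v \<bullet> (A *v v)" "\<And>i j. A $ i $ j \<noteq> 0 \<Longrightarrow> i \<in> S \<and> j \<in> S"
    for A :: "real ^ 'n ^ 'n" and S
    using that
  proof (induction S arbitrary: A rule: finite_induct)
    case empty
    then have "A $ i $ j = 0" for i j by auto
    then show ?case by simp
  next
    case (insert s S)
    note sym = insert.prems(1) and psd = insert.prems(2) and supp = insert.prems(3)
    have symc: "A $ i $ j = A $ j $ i" for i j
      using arg_cong[OF sym, of "\<lambda>M. M $ i $ j"] by (simp add: transpose_def)
    define w where "w = A *v axis s 1"
    have w: "w $ i = A $ i $ s" for i by (simp add: w_def matrix_axis_component)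
    define \<alpha> where "\<alpha> = A $ s $ s"
    have \<alpha>: "axis s 1 \<bullet> (A *v axis s 1) = \<alpha>"
      by (simp add: inner_axis' matrix_axis_component \<alpha>_def)
    then have \<alpha>0: "\<alpha> \<ge> 0" using psd[of "axis s 1"] by simp
    have expand: "(v + t *\<^sub>R axis s 1) \<bullet> (A *v (v + t *\<^sub>R axis s 1))
      = v \<bullet> (A *v v) + 2 * t * (v \<bullet> w) + t\<^sup>2 * \<alpha>" for v t
      using quadratic_form_add[OF sym, of v t "axis s 1"] \<alpha> by (simp add: w_def)
    show ?case
    proof (cases "\<alpha> = 0")
      case True
      have "A $ j $ s = 0" for j
      proof -
        have "0 \<le> A $ j $ j + 2 * t * A $ j $ s" for t
          using psd[of "axis j 1 + t *\<^sub>R axis s 1"] expand[of "axis j 1" t] True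
          by (simp add: inner_axis' matrix_axis_component w)
        \<comment> \<open>an affine function of t that is bounded below is constant; this t would give the value -1\<close>
        from this[of "- (A $ j $ j + 1) / (2 * A $ j $ s)"] show ?thesis
          by (cases "A $ j $ s = 0") (auto simp: field_simps)
      qed
      then have "\<And>i j. A $ i $ j \<noteq> 0 \<Longrightarrow> i \<in> S \<and> j \<in> S"
        using supp symc by (metis insert_iff)
      then show ?thesis using insert.IH[OF sym psd] by blast
    next
      case False
      then have pos: "\<alpha> > 0" using \<alpha>0 by simp
      define A' where "A' = A - (1 / \<alpha>) *\<^sub>R (\<chi> i j. w $ i * w $ j)"
      have A'c: "A' $ i $ j = A $ i $ j - w $ i * w $ j / \<alpha>" for i j
        by (simp add: A'_def)
      have "0 \<le> (\<Sum>i\<in>UNIV. \<Sum>j\<in>UNIV. A' $ i $ j * B $ i $ j)"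
      proof (rule insert.IH)
        show "transpose A' = A'"
          by (simp add: vec_eq_iff transpose_def A'c symc mult.commute)
        show "0 \<le> v \<bullet> (A' *v v)" for v
        proof -
          have "v \<bullet> (A' *v v) = v \<bullet> (A *v v) - (v \<bullet> w)\<^sup>2 / \<alpha>"
            by (simp add: A'_def matrix_vector_mult_diff_rdistrib scaleR_matrix_vector_assoc[symmetric]
                outer_mult_vec inner_diff_right power2_eq_square inner_commute)
          \<comment> \<open>the value of the form of A at its minimum on the line through v in direction s\<close>
          also have "\<dots> = v \<bullet> (A *v v) + 2 * (- (v \<bullet> w) / \<alpha>) * (v \<bullet> w) + (- (v \<bullet> w) / \<alpha>)\<^sup>2 * \<alpha>"
            using pos by (simp add: field_simps power2_eq_square)
          also have "\<dots> \<ge> 0"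
            using psd[of "v + (- (v \<bullet> w) / \<alpha>) *\<^sub>R axis s 1"] unfolding expand by simp
          finally show ?thesis .
        qed
        show "i \<in> S \<and> j \<in> S" if nz: "A' $ i $ j \<noteq> 0" for i j
        proof -
          have "A' $ i $ s = 0" "A' $ s $ i = 0" for i
            using pos by (simp_all add: A'c w \<alpha>_def symc[of s i])
          then have "i \<noteq> s" "j \<noteq> s" using nz by metis+
          moreover have "i \<in> insert s S"
          proof (rule ccontr)
            assume "i \<notin> insert s S"
            then have "A $ i $ j = 0" "A $ i $ s = 0" using supp by blast+
            then show False using nz by (simp add: A'c w)
          qed
          moreover have "j \<in> insert s S"
          proof (rule ccontr)
            assume "j \<notin> insert s S"
            then have "A $ i $ j = 0" "A $ j $ s = 0" using supp by blast+
            then show False using nz by (simp add: A'c w)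
          qed
          ultimately show ?thesis by simp
        qed
      qed
      also have "\<dots> = (\<Sum>i\<in>UNIV. \<Sum>j\<in>UNIV. A $ i $ j * B $ i $ j)
          - (\<Sum>i\<in>UNIV. \<Sum>j\<in>UNIV. (w $ i * w $ j) * B $ i $ j) / \<alpha>"
        by (simp add: A'c left_diff_distrib sum_subtractf sum_divide_distrib)
      finally show ?thesis
        using B[of w] pos by (simp add: sum_outer_eq_quadratic_form) (smt (verit) divide_nonneg_pos)
    qed
  qed
  from this[of UNIV, OF finite assms(1,2)] show ?thesis by simp
qed

lemma pos_definite_coercive:
  fixes A :: "real ^ 'n::finite ^ 'n"
  assumes "pos_definite A"
  obtains m where "m > 0" "\<And>v. m * (norm v)\<^sup>2 \<le> v \<bullet> (A *v v)"
proof -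
  have cont: "continuous_on (sphere 0 1) (\<lambda>v. v \<bullet> (A *v v))"
    by (intro continuous_intros linear_continuous_on_compose matrix_vector_mul_linear)
  have ne: "(sphere 0 1 :: (real ^ 'n) set) \<noteq> {}" by simp
  obtain w where w: "w \<in> sphere 0 1" "\<And>v. v \<in> sphere 0 1 \<Longrightarrow> w \<bullet> (A *v w) \<le> v \<bullet> (A *v v)"
    using continuous_attains_inf[OF compact_sphere ne cont] by blast
  show ?thesis
  proof (rule that)
    have "w \<noteq> 0" using w(1) by auto
    then show "0 < w \<bullet> (A *v w)" using assms by (simp add: pos_definite_def)
    show "w \<bullet> (A *v w) * (norm v)\<^sup>2 \<le> v \<bullet> (A *v v)" for v
    proof (cases "v = 0")
      case False
      define e where "e = v /\<^sub>R norm v"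
      have "e \<in> sphere 0 1" using False by (simp add: e_def)
      moreover have v: "v = norm v *\<^sub>R e" using False by (simp add: e_def)
      have "v \<bullet> (A *v v) = (norm v)\<^sup>2 * (e \<bullet> (A *v e))"
        by (subst (1 2) v) (simp add: matrix_vector_mult_scaleR power2_eq_square)
      ultimately show ?thesis
        using mult_right_mono[OF w(2), of e "(norm v)\<^sup>2"] by (simp add: mult.commute)
    qed simp
  qed
qed

text \<open>
  A positive definite \<open>A\<close> stays semidefinite after subtracting a small positive multiple of \<open>v v\<^sup>T\<close>,
  which would make the sum negative if \<open>v \<bullet> B v\<close> were positive.
\<close>

theorem sum_mult_pos_definite_eq_0:
  fixes A B :: "real ^ 'n::finite ^ 'n"
  assumes sym: "transpose A = A" and pd: "pos_definite A" and B: "\<And>v. 0 \<le> v \<bullet> (B *v v)"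
    and zero: "(\<Sum>i\<in>UNIV. \<Sum>j\<in>UNIV. A $ i $ j * B $ i $ j) = 0"
  shows "v \<bullet> (B *v v) = 0"
proof (cases "v = 0")
  case False
  obtain m where m: "m > 0" "\<And>v. m * (norm v)\<^sup>2 \<le> v \<bullet> (A *v v)"
    using pos_definite_coercive[OF pd] by blast
  define \<epsilon> where "\<epsilon> = m / (norm v)\<^sup>2"
  have \<epsilon>: "\<epsilon> > 0" using m False by (simp add: \<epsilon>_def)
  define A' where "A' = A - \<epsilon> *\<^sub>R (\<chi> i j. v $ i * v $ j)"
  have A'c: "A' $ i $ j = A $ i $ j - \<epsilon> * (v $ i * v $ j)" for i j
    by (simp add: A'_def)
  have symc: "A $ i $ j = A $ j $ i" for i j
    using arg_cong[OF sym, of "\<lambda>M. M $ i $ j"] by (simp add: transpose_def)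
  have "0 \<le> (\<Sum>i\<in>UNIV. \<Sum>j\<in>UNIV. A' $ i $ j * B $ i $ j)"
  proof (rule sum_mult_psd_nonneg[OF _ _ B])
    show "transpose A' = A'"
      by (simp add: vec_eq_iff transpose_def A'c symc mult.commute)
    show "0 \<le> x \<bullet> (A' *v x)" for x
    proof -
      have "(v \<bullet> x)\<^sup>2 \<le> (norm v)\<^sup>2 * (norm x)\<^sup>2"
        using Cauchy_Schwarz_ineq[of v x] by (simp add: power2_norm_eq_inner)
      then have "\<epsilon> * (v \<bullet> x)\<^sup>2 \<le> \<epsilon> * ((norm v)\<^sup>2 * (norm x)\<^sup>2)"
        using \<epsilon> by (intro mult_left_mono) auto
      also have "\<dots> = m * (norm x)\<^sup>2"
        using False by (simp add: \<epsilon>_def)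
      also have "\<dots> \<le> x \<bullet> (A *v x)" by (rule m)
      finally show ?thesis
        by (simp add: A'_def matrix_vector_mult_diff_rdistrib scaleR_matrix_vector_assoc[symmetric]
                outer_mult_vec inner_diff_right power2_eq_square inner_commute)
    qed
  qed
  also have "\<dots> = (\<Sum>i\<in>UNIV. \<Sum>j\<in>UNIV. A $ i $ j * B $ i $ j)
          - \<epsilon> * (\<Sum>i\<in>UNIV. \<Sum>j\<in>UNIV. (v $ i * v $ j) * B $ i $ j)"
    by (simp add: A'c left_diff_distrib sum_subtractf sum_distrib_left mult.assoc)
  finally have "\<epsilon> * (v \<bullet> (B *v v)) \<le> 0"
    using zero by (simp add: sum_outer_eq_quadratic_form)
  then show ?thesis using \<epsilon> B[of v] by (simp add: mult_le_0_iff) 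
qed simp

lemma pos_definite_invertible:
  fixes A :: "real ^ 'n::finite ^ 'n"
  assumes "pos_definite A"
  shows "invertible A"
proof -
  have "A *v x = 0 \<Longrightarrow> x = 0" for x
    using assms unfolding pos_definite_def by (metis inner_zero_right less_irrefl)
  then show ?thesis
    by (simp add: invertible_left_inverse matrix_left_invertible_ker)
qed

lemma matrix_mult_matrix_inv:
  fixes A :: "real ^ 'n::finite ^ 'n"
  assumes "invertible A"
  shows "A ** matrix_inv A = mat 1"
  using assms unfolding invertible_def matrix_inv_def by (metis (mono_tags, lifting) someI_ex)

lemma pos_definite_matrix_inv:
  fixes A :: "real ^ 'n::finite ^ 'n"
  assumes "pos_definite A"
  shows "pos_definite (matrix_inv A)"
  unfolding pos_definite_def
proof (intro allI impI)
  fix v :: "real ^ 'n" assume "v \<noteq> 0"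
  define w where "w = matrix_inv A *v v"
  have v: "v = A *v w"
    unfolding w_def using matrix_mult_matrix_inv[OF pos_definite_invertible[OF assms]]
    by (simp add: matrix_vector_mul_assoc)
  have "w \<noteq> 0" using \<open>v \<noteq> 0\<close> v by auto
  then have "0 < w \<bullet> (A *v w)" using assms by (simp add: pos_definite_def)
  moreover have "v \<bullet> (matrix_inv A *v v) = w \<bullet> (A *v w)"
    unfolding w_def[symmetric] v[symmetric] by (rule inner_commute)
  ultimately show "0 < v \<bullet> (matrix_inv A *v v)" by simp
qed

lemma transpose_matrix_inv:
  fixes A :: "real ^ 'n::finite ^ 'n"
  assumes "invertible A" "transpose A = A"
  shows "transpose (matrix_inv A) = matrix_inv A"
proof -
  let ?B = "matrix_inv A"
  have "transpose ?B ** A = mat 1"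
    using arg_cong[OF matrix_mult_matrix_inv[OF assms(1)], of transpose] assms(2)
    by (simp add: matrix_transpose_mul transpose_mat)
  then have "transpose ?B ** A ** ?B = ?B" by simp
  then show ?thesis
    using matrix_mult_matrix_inv[OF assms(1)] by (simp add: matrix_mul_assoc[symmetric])
qed

lemma quadratic_form_eq_0_imp_eq_0:
  fixes B :: "real ^ 'n::finite ^ 'n"
  assumes sym: "transpose B = B" and zero: "\<And>v. v \<bullet> (B *v v) = 0"
  shows "B = 0"
proof -
  have "x \<bullet> (B *v y) = 0" for x y
    using quadratic_form_add[OF sym, of x 1 y] by (simp add: zero)
  from this[of "axis i 1" "axis j 1" for i j] have "B $ i $ j = 0" for i j
    by (simp add: inner_axis' matrix_axis_component)
  then show ?thesis by (simp add: vec_eq_iff)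
qed

section \<open>Convexity and the Hessian\<close>

lemma transpose_hessian:
  assumes "open S" "x \<in> S" "Ck_on 2 S g"
  shows "transpose (hessian g x) = hessian g x"
  using partial_commute[OF assms] by (simp add: hessian_def transpose_def vec_eq_iff)

lemma second_derivative_along_line:
  fixes g :: "real ^ 'n::finite \<Rightarrow> real"
  assumes "Ck_on 2 S g" "x + t *\<^sub>R v \<in> S"
  shows "((\<lambda>s. g (x + s *\<^sub>R v)) has_real_derivative (\<Sum>i\<in>UNIV. v $ i * partial i g (x + t *\<^sub>R v))) (at t)"
    and "((\<lambda>s. \<Sum>i\<in>UNIV. v $ i * partial i g (x + s *\<^sub>R v)) has_real_derivative
           v \<bullet> (hessian g (x + t *\<^sub>R v) *v v)) (at t)"
proof -
  have C2: "Ck_on (Suc (Suc 0)) S g" using assms(1) by (simp add: numeral_2_eq_2)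
  have line: "((\<lambda>s. x + s *\<^sub>R v) has_derivative (\<lambda>h. h *\<^sub>R v)) (at t)"
    by (auto intro!: derivative_eq_intros)
  have along: "((\<lambda>s. k (x + s *\<^sub>R v)) has_real_derivative (\<Sum>i\<in>UNIV. v $ i * partial i k (x + t *\<^sub>R v))) (at t)"
    if "Ck_on (Suc 0) S k" for k
  proof -
    note D = Ck_on_Suc_has_derivative[OF that assms(2)]
    have "((\<lambda>s. k (x + s *\<^sub>R v)) has_derivative
       (\<lambda>h. frechet_derivative k (at (x + t *\<^sub>R v)) (h *\<^sub>R v))) (at t)"
      using has_derivative_compose[OF line, of k] D by simp
    then show ?thesis
      using derivative_eq_sum_partial[OF D, of v]
      by (simp add: has_field_derivative_def linear_cmul[OF has_derivative_linear[OF D]] mult_commute_abs)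
  qed
  show "((\<lambda>s. g (x + s *\<^sub>R v)) has_real_derivative (\<Sum>i\<in>UNIV. v $ i * partial i g (x + t *\<^sub>R v))) (at t)"
    using C2 by (intro along) (rule Ck_on_SucD)
  have "((\<lambda>s. \<Sum>i\<in>UNIV. v $ i * partial i g (x + s *\<^sub>R v)) has_real_derivative
      (\<Sum>i\<in>UNIV. v $ i * (\<Sum>j\<in>UNIV. v $ j * partial j (partial i g) (x + t *\<^sub>R v)))) (at t)"
    using C2 by (intro DERIV_sum DERIV_cmult along) simp
  moreover have "v \<bullet> (hessian g (x + t *\<^sub>R v) *v v)
      = (\<Sum>i\<in>UNIV. v $ i * (\<Sum>j\<in>UNIV. v $ j * partial j (partial i g) (x + t *\<^sub>R v)))"
    by (simp add: inner_vec_def matrix_vector_mult_def hessian_def mult.commute)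
  ultimately show "((\<lambda>s. \<Sum>i\<in>UNIV. v $ i * partial i g (x + s *\<^sub>R v)) has_real_derivative
           v \<bullet> (hessian g (x + t *\<^sub>R v) *v v)) (at t)" by simp
qed

text \<open>
  Along a line a convex function lies above its tangents, so its derivative is monotone, which excludes
  a negative second derivative.
\<close>

theorem convex_on_imp_hessian_psd:
  fixes g :: "real ^ 'n::finite \<Rightarrow> real"
  assumes S: "open S" "x \<in> S" and C2: "Ck_on 2 S g" and convex: "convex_on S g"
  shows "0 \<le> v \<bullet> (hessian g x *v v)"
proof (rule ccontr)
  assume neg: "\<not> 0 \<le> v \<bullet> (hessian g x *v v)"
  define I where "I = (\<lambda>s. x + s *\<^sub>R v) -` S"
  define q where "q = (\<lambda>s. g (x + s *\<^sub>R v))"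
  define q' where "q' = (\<lambda>s. \<Sum>i\<in>UNIV. v $ i * partial i g (x + s *\<^sub>R v))"
  have Sc: "convex S" using convex by (rule convex_on_imp_convex)
  have comb: "x + ((1 - t) * r + t * s) *\<^sub>R v = (1 - t) *\<^sub>R (x + r *\<^sub>R v) + t *\<^sub>R (x + s *\<^sub>R v)" for r s t
    by (simp add: algebra_simps)
  have I: "open I"
    unfolding I_def by (intro open_vimage S continuous_intros)
  have Ic: "convex I"
    unfolding convex_alt I_def using convexD_alt[OF Sc] by (auto simp: comb)
  have qc: "convex_on I q"
  proof (rule convex_onI[OF _ Ic])
    fix t r s :: real assume "0 < t" "t < 1" "r \<in> I" "s \<in> I"
    then show "q ((1 - t) *\<^sub>R r + t *\<^sub>R s) \<le> (1 - t) * q r + t * q s"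
      unfolding q_def using convex_onD[OF convex, of t "x + r *\<^sub>R v" "x + s *\<^sub>R v"]
      by (simp add: comb I_def)
  qed
  have dq: "(q has_real_derivative q' t) (at t)" if "t \<in> I" for t
    using second_derivative_along_line(1)[OF C2, of x t v] that by (simp add: q_def q'_def I_def)
  have tangent: "q s - q r \<ge> q' r * (s - r)" if "r \<in> I" "s \<in> I" for r s
    using that I dq[of r] Ic
    by (intro convex_on_imp_above_tangent[OF qc])
       (auto simp: interior_open convex_connected intro: has_field_derivative_at_within)
  have "(q' has_real_derivative v \<bullet> (hessian g x *v v)) (at 0)"
    using second_derivative_along_line(2)[OF C2, of x 0 v] S(2) by (simp add: q'_def)
  then obtain d where d: "d > 0" "\<And>h. 0 < h \<Longrightarrow> h < d \<Longrightarrow> q' (0 + h) < q' 0"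
    using DERIV_neg_dec_right neg by (metis not_le)
  have "0 \<in> I" using S by (simp add: I_def)
  then obtain e where e: "e > 0" "ball 0 e \<subseteq> I"
    using I open_contains_ball by blast
  define h where "h = min d e / 2"
  have h: "0 < h" "h < d" "h \<in> I"
    using d(1) e by (auto simp: h_def subset_iff dist_real_def min_def)
  have "q' 0 * h \<le> q h - q 0" "q' h * (0 - h) \<le> q 0 - q h"
    using tangent[of 0 h] tangent[of h 0] h \<open>0 \<in> I\<close> by auto
  then have "q' 0 * h \<le> q' h * h" by (simp add: algebra_simps)
  then have "q' 0 \<le> q' h" using h(1) by simp
  with d(2)[OF h(1,2)] show False by simp
qed

theorem hessian_eq_0_imp_affine:
  fixes g :: "real ^ 'n::finite \<Rightarrow> real"
  assumes S: "open S" "convex S" and C2: "Ck_on 2 S g" and H: "\<And>x. x \<in> S \<Longrightarrow> hessian g x = 0"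
  shows "affine_fun_on S g"
proof -
  have C2': "Ck_on (Suc (Suc 0)) S g" using C2 by (simp add: numeral_2_eq_2)
  have "\<exists>c. \<forall>x\<in>S. partial i g x = c" for i
  proof -
    have "\<exists>c. \<forall>x\<in>S. partial i g x = c"
    proof (rule has_derivative_zero_constant[OF S(2)])
      fix x assume x: "x \<in> S"
      have C1: "Ck_on (Suc 0) S (partial i g)" using C2' by simp
      note D = Ck_on_Suc_has_derivative[OF C1 x]
      have "partial j (partial i g) x = 0" for j
        using arg_cong[OF H[OF x], of "\<lambda>M. M $ i $ j"] by (simp add: hessian_def)
      then have "frechet_derivative (partial i g) (at x) = (\<lambda>h. 0)"
        using derivative_eq_sum_partial[OF D] by (simp add: fun_eq_iff)
      then show "(partial i g has_derivative (\<lambda>h. 0)) (at x within S)"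
        using D by (simp add: has_derivative_at_withinI)
    qed
    then show ?thesis by blast
  qed
  then obtain c where c: "\<And>i x. x \<in> S \<Longrightarrow> partial i g x = c i" by metis
  define v :: "real ^ 'n" where "v = (\<chi> i. c i)"
  have "\<exists>b. \<forall>x\<in>S. g x - v \<bullet> x = b"
  proof (rule has_derivative_zero_constant[OF S(2)])
    fix x assume x: "x \<in> S"
    note D = Ck_on_Suc_has_derivative[OF C2' x]
    have "frechet_derivative g (at x) = (\<lambda>h. v \<bullet> h)"
      using derivative_eq_sum_partial[OF D] c[OF x] by (simp add: fun_eq_iff v_def inner_vec_def mult.commute)
    then have "(g has_derivative (\<lambda>h. v \<bullet> h)) (at x within S)"
      using D by (simp add: has_derivative_at_withinI)
    then have "((\<lambda>x. g x - v \<bullet> x) has_derivative (\<lambda>h. v \<bullet> h - v \<bullet> h)) (at x within S)"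
      by (intro has_derivative_diff) (auto intro!: derivative_eq_intros)
    then show "((\<lambda>x. g x - v \<bullet> x) has_derivative (\<lambda>h. 0)) (at x within S)" by simp
  qed
  then obtain b where "\<forall>x\<in>S. g x = v \<bullet> x + b" by (auto simp: algebra_simps)
  then show ?thesis unfolding affine_fun_on_def by blast
qed

section \<open>Facets and the boundary conditions\<close>

lemma convex_polytope_of: "convex (polytope_of d u a)"
proof -
  have "polytope_of d u a = (\<Inter>j\<in>{..<d}. {x. u j \<bullet> x \<ge> - a j})"
  proof -
    have "0 \<le> u j \<bullet> x + a j \<longleftrightarrow> - a j \<le> u j \<bullet> x" for j x by linarith
    then show ?thesis by (auto simp: polytope_of_def label_def)
  qed
  then show ?thesis
    by (auto intro!: convex_INT convex_halfspace_ge)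
qed

lemma compact_facet: "compact (polytope_of d u a) \<Longrightarrow> compact (facet d u a j)"
  using closed_facet facet_subset by (metis Int_absorb1 compact_Int_closed)

lemma normal_nonzero:
  assumes "labelled_delzant \<Lambda> d u a" "j < d"
  shows "u j \<noteq> 0"
proof
  assume "u j = 0"
  have F: "facet d u a j facet_of polytope_of d u a"
    using assms by (simp add: labelled_delzant_def)
  then obtain x where "x \<in> facet d u a j" by (auto simp: facet_of_def)
  then have "facet d u a j = polytope_of d u a"
    using \<open>u j = 0\<close> by (auto simp: facet_def label_def)
  then show False using F by (simp add: facet_of_def)
qed

text \<open>
  Otherwise one facet would contain the other, and faces of equal dimension that are nested coincide.
\<close>

lemma facet_hyperplanes_distinct:
  assumes D: "labelled_delzant \<Lambda> d u a" and jk: "j < d" "k < d" "k \<noteq> j"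
  shows "\<exists>y. label u a j y = 0 \<and> label u a k y \<noteq> 0"
proof (rule ccontr)
  assume "\<not> ?thesis"
  then have sub: "facet d u a j \<subseteq> facet d u a k" by (auto simp: facet_def)
  have F: "facet d u a i facet_of polytope_of d u a" if "i < d" for i
    using D that by (simp add: labelled_delzant_def)
  have "facet d u a j face_of facet d u a k"
    using F[OF jk(1)] sub facet_subset by (meson face_of_subset facet_of_def)
  moreover have "convex (facet d u a k)"
    using F[OF jk(2)] face_of_imp_convex by (auto simp: facet_of_def)
  moreover have "aff_dim (facet d u a j) = aff_dim (facet d u a k)"
    using F jk by (simp add: facet_of_def)
  ultimately have "facet d u a j = facet d u a k"
    using face_of_aff_dim_lt by fastforce
  then show False
    using D jk by (auto simp: labelled_delzant_def inj_on_def)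
qed

text \<open>
  A facet has codimension one, so the directions from one of its points into it fill the orthogonal
  complement of the normal.
\<close>

lemma facet_directions_span:
  assumes D: "labelled_delzant \<Lambda> d u a" and j: "j < d" and \<xi>: "\<xi> \<in> facet d u a j" and v: "u j \<bullet> v = 0"
  shows "v \<in> span ((\<lambda>y. y - \<xi>) ` facet d u a j)"
proof -
  let ?P = "(\<lambda>y. y - \<xi>) ` facet d u a j"
  have int: "interior (polytope_of d u a) \<noteq> {}" and F: "facet d u a j facet_of polytope_of d u a"
    using D j by (auto simp: labelled_delzant_def)
  have "aff_dim (facet d u a j) = int (dim ?P)"
    using \<xi> by (intro aff_dim_eq_dim_subtract hull_inc)
  moreover have "aff_dim (facet d u a j) = int DIM(real ^ 'a) - 1"
    using F aff_dim_nonempty_interior[OF int] by (simp add: facet_of_def)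
  ultimately have "dim (span ?P) = DIM(real ^ 'a) - 1" by simp
  moreover have "dim {x. u j \<bullet> x = 0} = DIM(real ^ 'a) - 1"
    using normal_nonzero[OF D j] by (rule dim_hyperplane)
  moreover have "span ?P \<subseteq> {x. u j \<bullet> x = 0}"
  proof (rule span_minimal)
    show "?P \<subseteq> {x. u j \<bullet> x = 0}"
      using \<xi> by (auto simp: facet_def label_def inner_diff_right algebra_simps)
    show "subspace {x. u j \<bullet> x = 0}" by (rule subspace_hyperplane)
  qed
  ultimately have "span ?P = {x. u j \<bullet> x = 0}"
    by (intro subspace_dim_equal) (auto simp: subspace_hyperplane)
  then show ?thesis using v by simp
qed

lemma has_vector_derivative_along_segment:
  assumes f: "(f has_derivative D) (at x within S)"
    and seg: "\<And>t. 0 \<le> t \<Longrightarrow> t \<le> 1 \<Longrightarrow> x + t *\<^sub>R (y - x) \<in> S"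
  shows "((\<lambda>t. f (x + t *\<^sub>R (y - x))) has_vector_derivative D (y - x)) (at 0 within {0..1})"
proof -
  have l: "((\<lambda>t. x + t *\<^sub>R (y - x)) has_derivative (\<lambda>t. t *\<^sub>R (y - x))) (at 0 within {0..1})"
    by (auto intro!: derivative_eq_intros)
  have "(f has_derivative D) (at (x + 0 *\<^sub>R (y - x)) within (\<lambda>t. x + t *\<^sub>R (y - x)) ` {0..1})"
  proof -
    have "(\<lambda>t. x + t *\<^sub>R (y - x)) ` {0..1} \<subseteq> S" using seg by auto
    from has_derivative_subset[OF f this] show ?thesis by simp
  qed
  from has_derivative_in_compose[OF l this]
  show ?thesis
    by (simp add: has_vector_derivative_def linear_cmul[OF has_derivative_linear[OF f]])
qed

lemma at_0_within_unit_interval: "at (0::real) within {0..1} \<noteq> bot"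
  by (simp add: trivial_limit_within islimpt_Icc)

text \<open>
  A derivative within a convex set is determined on the directions that point into the set, and these
  span the space.  Near a vertex of a polytope there may be no coordinate direction among them.
\<close>

lemma has_derivative_within_convex_unique:
  fixes f :: "'a::euclidean_space \<Rightarrow> 'b::real_normed_vector"
  assumes S: "convex S" "interior S \<noteq> {}" "x \<in> S"
    and D: "(f has_derivative D) (at x within S)" "(f has_derivative D') (at x within S)"
  shows "D = D'"
proof
  fix v :: 'a
  have lin: "linear D" "linear D'" using D has_derivative_linear by auto
  have eq: "D (y - x) = D' (y - x)" if "y \<in> S" for y
  proof -
    have seg: "x + t *\<^sub>R (y - x) \<in> S" if "0 \<le> t" "t \<le> 1" for t
      using convexD_alt[OF S(1,3) \<open>y \<in> S\<close> that] by (simp add: algebra_simps)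
    show ?thesis
      using has_vector_derivative_along_segment[OF D(1) seg] has_vector_derivative_along_segment[OF D(2) seg]
      by (intro vector_derivative_unique_within[OF at_0_within_unit_interval])
  qed
  obtain z where "z \<in> interior S" using S by blast
  then obtain e where e: "e > 0" "ball z e \<subseteq> S" by (auto simp: mem_interior)
  define n where "n = norm v + 1"
  have n: "n > 0" "norm v \<le> n" by (simp_all add: n_def add_nonneg_pos)
  define c where "c = e / (2 * n)"
  have c: "c > 0" using e n by (simp add: c_def)
  have "norm (c *\<^sub>R v) < e"
  proof -
    have "norm (c *\<^sub>R v) \<le> c * n" using c n by simp
    also have "\<dots> = e / 2" using n by (simp add: c_def)
    finally show ?thesis using e by simp
  qed
  then have "z + c *\<^sub>R v \<in> S" "z \<in> S" using e by (auto simp: subset_iff dist_norm)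
  then have "D ((z + c *\<^sub>R v) - x) - D (z - x) = D' ((z + c *\<^sub>R v) - x) - D' (z - x)"
    using eq by simp
  then have "D (c *\<^sub>R v) = D' (c *\<^sub>R v)"
    by (simp add: linear_diff[OF lin(1), symmetric] linear_diff[OF lin(2), symmetric])
  then show "D v = D' v"
    using c by (simp add: linear_cmul[OF lin(1)] linear_cmul[OF lin(2)])
qed

lemma eq_on_polytope_if_eq_on_interior:
  fixes g h :: "real ^ 'n::finite \<Rightarrow> 'b::real_normed_vector"
  assumes int: "interior (polytope_of d u a) \<noteq> {}"
    and g: "continuous_on (polytope_of d u a) g" and h: "continuous_on (polytope_of d u a) h"
    and eq: "\<And>x. x \<in> interior (polytope_of d u a) \<Longrightarrow> g x = h x" and x: "x \<in> polytope_of d u a"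
  shows "g x = h x"
proof -
  have cl: "closure (interior (polytope_of d u a)) = polytope_of d u a"
    using convex_closure_interior[OF convex_polytope_of int] closure_closed[OF closed_polytope_of] by metis
  have "g x - h x = 0"
    by (rule continuous_constant_on_closure[of "interior (polytope_of d u a)" "\<lambda>x. g x - h x"])
       (use eq x g h in \<open>auto simp: cl intro: continuous_on_diff\<close>)
  then show ?thesis by simp
qed

text \<open>
  The divergence of the vector field \<open>H u\<^sub>j\<close> at a point of the facet \<open>F\<^sub>j\<close>.  As \<open>H u\<^sub>j\<close> vanishes on the
  facet, its derivative \<open>M\<close> kills the directions orthogonal to \<open>u\<^sub>j\<close>, so the trace of \<open>M\<close> is
  \<open>(u\<^sub>j \<bullet> M u\<^sub>j) / (u\<^sub>j \<bullet> u\<^sub>j)\<close>, which the second boundary condition computes.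
\<close>

lemma boundary_conditions_divergence:
  fixes H :: "real ^ 'n::finite \<Rightarrow> real ^ 'n ^ 'n"
  assumes D: "labelled_delzant \<Lambda> d u a" and bc: "boundary_conditions d u a G"
    and HG: "\<And>x. x \<in> polytope_of d u a \<Longrightarrow> H x = G x"
    and j: "j < d" and \<xi>: "\<xi> \<in> facet d u a j" and H': "(H has_derivative H') (at \<xi>)"
  shows "(\<Sum>i\<in>UNIV. (H' (axis i 1) *v u j) $ i) = 2"
proof -
  let ?\<Delta> = "polytope_of d u a"
  have int: "interior ?\<Delta> \<noteq> {}" using D by (simp add: labelled_delzant_def)
  have \<xi>\<Delta>: "\<xi> \<in> ?\<Delta>" using \<xi> facet_subset by blast
  have uu: "u j \<bullet> u j \<noteq> 0" using normal_nonzero[OF D j] by simp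
  have H'within: "(G has_derivative H') (at \<xi> within ?\<Delta>)"
    by (rule has_derivative_transform[OF \<xi>\<Delta> _ has_derivative_at_withinI[OF H']]) (simp add: HG)
  \<comment> \<open>The boundary conditions use the derivative within the polytope; it is that of any smooth
      extension.\<close>
  have "frechet_derivative G (at \<xi> within ?\<Delta>) = H'"
    using H'within frechet_derivative_works differentiableI
    by (intro has_derivative_within_convex_unique[OF convex_polytope_of int \<xi>\<Delta>]) blast+
  then have bc2: "u j \<bullet> (H' v *v u j) = (2 *\<^sub>R u j) \<bullet> v" for v
    using bc j \<xi> by (auto simp: boundary_conditions_def)
  have lin': "linear H'" using H' by (rule has_derivative_linear)
  define M where "M = (\<lambda>v. H' v *v u j)"
  have lin: "linear M"
    unfolding M_def
    by (rule linearI) (simp_all add: linear_add[OF lin'] linear_cmul[OF lin'] matrix_vector_mult_add_rdistrib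
        scaleR_matrix_vector_assoc)
  have zero_F: "M (y - \<xi>) = 0" if y: "y \<in> facet d u a j" for y
  proof -
    have cF: "convex (facet d u a j)"
      using D j face_of_imp_convex by (auto simp: labelled_delzant_def facet_of_def)
    have seg: "\<xi> + t *\<^sub>R (y - \<xi>) \<in> facet d u a j" if "0 \<le> t" "t \<le> 1" for t
      using convexD_alt[OF cF \<xi> y that] by (simp add: algebra_simps)
    have "((\<lambda>t. H (\<xi> + t *\<^sub>R (y - \<xi>))) has_vector_derivative H' (y - \<xi>)) (at 0 within {0..1})"
      by (rule has_vector_derivative_along_segment[OF has_derivative_at_withinI[OF H'] seg])
    then have "((\<lambda>t. H (\<xi> + t *\<^sub>R (y - \<xi>)) *v u j) has_vector_derivative H' (y - \<xi>) *v u j) (at 0 within {0..1})"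
    proof (rule bounded_linear.has_vector_derivative[rotated])
      have "linear (\<lambda>A :: real ^ 'n ^ 'n. A *v u j)"
        by (rule linearI) (simp_all add: matrix_vector_mult_add_rdistrib scaleR_matrix_vector_assoc)
      then show "bounded_linear (\<lambda>A :: real ^ 'n ^ 'n. A *v u j)"
        by (simp add: linear_conv_bounded_linear)
    qed
    moreover have "((\<lambda>t. H (\<xi> + t *\<^sub>R (y - \<xi>)) *v u j) has_vector_derivative 0) (at 0 within {0..1})"
    proof (rule has_vector_derivative_transform[OF _ _ has_vector_derivative_const[of 0]])
      fix t :: real assume "t \<in> {0..1}"
      then have "\<xi> + t *\<^sub>R (y - \<xi>) \<in> facet d u a j" using seg by auto
      then show "H (\<xi> + t *\<^sub>R (y - \<xi>)) *v u j = 0"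
        using bc j HG facet_subset[of d u a j] by (auto simp: boundary_conditions_def)
    qed simp
    ultimately show ?thesis
      unfolding M_def using vector_derivative_unique_within[OF at_0_within_unit_interval] by blast
  qed
  have zero: "M v = 0" if "u j \<bullet> v = 0" for v
    using zero_F by (intro linear_eq_0_on_span[OF lin _ facet_directions_span[OF D j \<xi> that]]) auto
  have M: "M v = ((u j \<bullet> v) / (u j \<bullet> u j)) *\<^sub>R M (u j)" for v
  proof -
    have "M (v - ((u j \<bullet> v) / (u j \<bullet> u j)) *\<^sub>R u j) = 0"
      using uu by (intro zero) (simp add: inner_diff_right)
    then show ?thesis by (simp add: linear_diff[OF lin] linear_cmul[OF lin])
  qed
  have "(\<Sum>i\<in>UNIV. M (axis i 1) $ i) = (\<Sum>i\<in>UNIV. (u j $ i / (u j \<bullet> u j)) * M (u j) $ i)"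
    by (subst M) (simp add: inner_axis)
  also have "\<dots> = (u j \<bullet> M (u j)) / (u j \<bullet> u j)"
    by (simp add: inner_vec_def[of "u j" "M (u j)"] sum_divide_distrib)
  also have "\<dots> = 2" using bc2[of "u j"] uu by (simp add: M_def)
  finally show ?thesis by (simp add: M_def)
qed

section \<open>Integrals over the polytope and its facets\<close>

lemma set_integrable_polytope:
  fixes g :: "real ^ 'n::finite \<Rightarrow> real"
  assumes "compact (polytope_of d u a)" "continuous_on (polytope_of d u a) g"
  shows "set_integrable lborel (polytope_of d u a) g"
  using borel_integrable_compact[OF assms] by (simp add: set_integrable_def)

text \<open>
  The unit slab over a bounded part of the hyperplane is bounded, so it has finite volume.
\<close>

lemma set_integrable_facet:
  fixes g :: "real ^ 'n::finite \<Rightarrow> real"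
  assumes cpt: "compact F" and g: "continuous_on F g" and u: "u \<noteq> 0"
  shows "set_integrable (hyperplane_measure u b) F g"
proof -
  define S where "S = {x. 0 \<le> u \<bullet> x + b \<and> u \<bullet> x + b \<le> 1}"
  have S[measurable]: "S \<in> sets borel" unfolding S_def by measurable
  have meas[measurable]: "(\<lambda>x. indicator F x * g x) \<in> borel_measurable borel"
    using cpt g by (intro indicator_mult_borel compact_imp_closed)
  obtain M where M: "M \<ge> 0" "\<And>x. x \<in> F \<Longrightarrow> \<bar>g x\<bar> \<le> M"
    using continuous_on_compact_bound[OF cpt g] by (metis real_norm_def)
  have "\<exists>R. \<forall>x\<in>F. norm x \<le> R" using compact_imp_bounded[OF cpt] by (simp add: bounded_iff)
  then obtain R where R: "\<And>x. x \<in> F \<Longrightarrow> norm x \<le> R" by blast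
  define G where "G = (\<lambda>x. indicator S x * (indicator F (slide u b 0 x) * g (slide u b 0 x)))"
  have "integrable lborel G"
  proof (rule integrable_bounded_support)
    show "G \<in> borel_measurable borel" unfolding G_def by measurable
    show "bounded (cball (0 :: real ^ 'n) (R + 1 / norm u))" by simp
    show "\<bar>G x\<bar> \<le> M" for x using M by (auto simp: G_def indicator_def)
    show "G x = 0" if "x \<notin> cball 0 (R + 1 / norm u)" for x
    proof (rule ccontr)
      assume "G x \<noteq> 0"
      then have x: "slide u b 0 x \<in> F" "x \<in> S" by (auto simp: G_def indicator_def split: if_splits)
      define s where "s = (u \<bullet> x + b) / (u \<bullet> u)"
      have "\<bar>s\<bar> * norm u = \<bar>u \<bullet> x + b\<bar> / norm u"
        using u by (simp add: s_def dot_square_norm power2_eq_square)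
      also have "\<dots> \<le> 1 / norm u" using x(2) by (intro divide_right_mono) (auto simp: S_def)
      finally have "norm (s *\<^sub>R u) \<le> 1 / norm u" by simp
      moreover have "x = slide u b 0 x + s *\<^sub>R u" by (simp add: slide_def s_def)
      then have "norm x \<le> norm (slide u b 0 x) + norm (s *\<^sub>R u)" by (metis norm_triangle_ineq)
      ultimately show False using R[OF x(1)] that by simp
    qed
  qed
  moreover have "slide u b 0 \<in> restrict_space lborel S \<rightarrow>\<^sub>M borel"
    by (rule measurable_restrict_space1) measurable
  moreover have "hyperplane_measure u b = distr (restrict_space lborel S) borel (slide u b 0)"
    by (simp add: hyperplane_measure_eq_distr_slide S_def)
  ultimately show ?thesis
    by (simp add: set_integrable_def integrable_distr_eq integrable_restrict_space G_def)
qed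

lemma set_integral_sum:
  fixes g :: "'i \<Rightarrow> 'a \<Rightarrow> real"
  assumes "\<And>i. i \<in> I \<Longrightarrow> set_integrable M A (g i)"
  shows "set_lebesgue_integral M A (\<lambda>x. \<Sum>i\<in>I. g i x) = (\<Sum>i\<in>I. set_lebesgue_integral M A (g i))"
  using assms by (simp add: set_lebesgue_integral_def set_integrable_def sum_distrib_left)

lemma facet_sets: "facet d u a j \<in> sets (hyperplane_measure v b)"
  by (simp add: hyperplane_measure_def closed_facet borel_closed)

lemma polytope_sets: "polytope_of d u a \<in> sets lborel"
  by (simp add: closed_polytope_of borel_closed)

lemma polytope_integral_cong:
  assumes "\<And>x. x \<in> polytope_of d u a \<Longrightarrow> g x = h x"
  shows "polytope_integral d u a g = polytope_integral d u a h"
  unfolding polytope_integral_def using assms by (intro set_lebesgue_integral_cong[OF polytope_sets]) auto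

lemma boundary_integral_cong:
  assumes "\<And>x. x \<in> polytope_of d u a \<Longrightarrow> g x = h x"
  shows "boundary_integral d u a g = boundary_integral d u a h"
  unfolding boundary_integral_def using assms facet_subset
  by (intro sum.cong refl set_lebesgue_integral_cong[OF facet_sets]) blast

lemma polytope_integral_nonneg:
  assumes "\<And>x. x \<in> polytope_of d u a \<Longrightarrow> 0 \<le> g x"
  shows "0 \<le> polytope_integral d u a g"
  unfolding polytope_integral_def set_lebesgue_integral_def
  by (rule Bochner_Integration.integral_nonneg) (use assms in \<open>auto simp: indicator_def\<close>)

lemma polytope_integral_eq_0_imp:
  assumes cpt: "compact (polytope_of d u a)" and g: "continuous_on (polytope_of d u a) g"
    and nonneg: "\<And>x. x \<in> polytope_of d u a \<Longrightarrow> 0 \<le> g x"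
    and zero: "polytope_integral d u a g = 0" and x: "x \<in> interior (polytope_of d u a)"
  shows "g x = 0"
proof (rule ccontr)
  let ?\<Delta> = "polytope_of d u a"
  assume "g x \<noteq> 0"
  have sub: "interior ?\<Delta> \<subseteq> ?\<Delta>" by (rule interior_subset)
  have "integrable lborel (\<lambda>x. indicator ?\<Delta> x * g x)"
    using set_integrable_polytope[OF cpt g] by (simp add: set_integrable_def)
  moreover have "AE x in lborel. 0 \<le> indicator ?\<Delta> x * g x"
    using nonneg by (auto simp: indicator_def)
  moreover have "(\<integral>x. indicator ?\<Delta> x * g x \<partial>lborel) = 0"
    using zero by (simp add: polytope_integral_def set_lebesgue_integral_def)
  ultimately have AE0: "AE x in lborel. indicator ?\<Delta> x * g x = 0"
    using integral_nonneg_eq_0_iff_AE by blast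
  define U where "U = interior ?\<Delta> \<inter> g -` {0<..}"
  have "open U"
    unfolding U_def by (intro continuous_open_preimage continuous_on_subset[OF g sub]) auto
  moreover have "x \<in> U"
    using x nonneg[of x] sub \<open>g x \<noteq> 0\<close> by (auto simp: U_def)
  moreover have "AE y in lborel. y \<notin> U"
    using AE0 by eventually_elim (use sub in \<open>auto simp: U_def indicator_def\<close>)
  ultimately have "U \<in> null_sets lborel"
    by (subst (asm) AE_iff_null_sets[symmetric]) auto
  then have "negligible U"
    using null_sets_completionI negligible_iff_null_sets by blast
  then show False using open_not_negligible \<open>open U\<close> \<open>x \<in> U\<close> by blast
qed

lemma polytope_integral_pos:
  assumes "compact (polytope_of d u a)" "interior (polytope_of d u a) \<noteq> {}"
    and "continuous_on (polytope_of d u a) g" and pos: "\<And>x. x \<in> polytope_of d u a \<Longrightarrow> 0 < g x"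
  shows "0 < polytope_integral d u a g"
proof -
  have "0 \<le> polytope_integral d u a g"
    using pos by (intro polytope_integral_nonneg) (simp add: less_imp_le)
  moreover have "polytope_integral d u a g \<noteq> 0"
    using polytope_integral_eq_0_imp[OF assms(1,3)] assms(2) pos interior_subset
    by (metis equals0I less_imp_le less_irrefl subsetD)
  ultimately show ?thesis by simp
qed

text \<open>
  If the integral vanished, every facet would be a null set of its measure, and the divergence theorem
  for a coordinate function would give \<open>\<Delta>\<close> the volume 0.
\<close>

lemma boundary_integral_pos:
  fixes g :: "real ^ 'n::finite \<Rightarrow> real"
  assumes D: "labelled_delzant \<Lambda> d u a"
    and g: "continuous_on (polytope_of d u a) g" and pos: "\<And>x. x \<in> polytope_of d u a \<Longrightarrow> 0 < g x"
  shows "0 < boundary_integral d u a g"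
proof -
  let ?\<Delta> = "polytope_of d u a"
  have cpt: "compact ?\<Delta>" and int: "interior ?\<Delta> \<noteq> {}"
    using D by (simp_all add: labelled_delzant_def)
  let ?I = "\<lambda>k g. set_lebesgue_integral (hyperplane_measure (u k) (a k)) (facet d u a k) g"
  have nonneg: "0 \<le> indicator (facet d u a k) x * g x" for k x
    using pos facet_subset[of d u a k] by (auto simp: indicator_def less_imp_le)
  have I0: "0 \<le> ?I k g" for k
    unfolding set_lebesgue_integral_def using nonneg by (intro Bochner_Integration.integral_nonneg) simp
  have "boundary_integral d u a g \<noteq> 0"
  proof
    assume "boundary_integral d u a g = 0"
    then have I: "?I k g = 0" if "k < d" for k
      using that I0 by (simp add: boundary_integral_def sum_nonneg_eq_0_iff)
    have null: "?I k h = 0" if k: "k < d" for k h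
    proof -
      have "set_integrable (hyperplane_measure (u k) (a k)) (facet d u a k) g"
        by (rule set_integrable_facet[OF compact_facet[OF cpt] continuous_on_subset[OF g facet_subset] normal_nonzero[OF D k]])
      then have "AE x in hyperplane_measure (u k) (a k). indicator (facet d u a k) x * g x = 0"
        using I[OF k] nonneg[of k]
        by (subst integral_nonneg_eq_0_iff_AE[symmetric])
           (auto simp: set_integrable_def set_lebesgue_integral_def)
      then have "AE x in hyperplane_measure (u k) (a k). indicator (facet d u a k) x *\<^sub>R h x = 0"
      proof eventually_elim
        case (elim x)
        then show ?case using pos[of x] facet_subset[of d u a k] by (auto simp: indicator_def split: if_splits)
      qed
      then show ?thesis unfolding set_lebesgue_integral_def by (rule integral_eq_zero_AE)
    qed
    \<comment> \<open>the divergence theorem for an arbitrary coordinate function\<close>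
    define i :: 'n where "i = undefined"
    have "polytope_integral d u a (\<lambda>x. axis i 1 $ i) = - (\<Sum>k<d. (u k \<bullet> axis i 1) * ?I k (\<lambda>x. x $ i))"
    proof (rule polytope_divergence[OF cpt _ _ open_UNIV])
      show "u k \<noteq> 0" if "k < d" for k using normal_nonzero[OF D that] .
      show "\<exists>y. label u a j y = 0 \<and> label u a k y \<noteq> 0" if "j < d" "k < d" "k \<noteq> j" for j k
        using facet_hyperplanes_distinct[OF D that] .
      show "((\<lambda>x :: real ^ 'n. x $ i) has_derivative (\<lambda>x. x $ i)) (at x)" for x
        by (rule bounded_linear_imp_has_derivative[OF bounded_linear_vec_nth])
    qed auto
    also have "\<dots> = - (\<Sum>k<d. 0)"
      by (intro arg_cong[of _ _ uminus] sum.cong) (simp_all add: null)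
    finally have "polytope_integral d u a (\<lambda>x. 1) = 0" by simp
    then show False
      using polytope_integral_pos[OF cpt int, of "\<lambda>x. 1"] by simp
  qed
  moreover have "0 \<le> boundary_integral d u a g"
    unfolding boundary_integral_def using I0 by (intro sum_nonneg)
  ultimately show ?thesis by simp
qed

section \<open>Integration by parts\<close>

text \<open>
  The divergence theorem for \<open>Y_j = \<Sum>i. (\<phi> h_ij,i - h_ji \<phi>_,i)\<close>, with \<open>h = p H\<close> and
  \<open>p = 1 / f^(2m-1)\<close>.  The test function \<open>\<psi>\<close> lives on a neighbourhood of the polytope, because its
  Hessian is taken in the full space also at boundary points.
\<close>

theorem weighted_integration_by_parts:
  fixes G :: "real ^ 'n::finite \<Rightarrow> real ^ 'n ^ 'n" and \<psi> :: "real ^ 'n \<Rightarrow> real"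
  assumes D: "labelled_delzant \<Lambda> d u a"
    and fa: "affine_fun_on UNIV f" and fpos: "\<And>x. x \<in> polytope_of d u a \<Longrightarrow> 0 < f x"
    and smG: "smooth_on (polytope_of d u a) G"
    and sym: "\<And>x. x \<in> polytope_of d u a \<Longrightarrow> transpose (G x) = G x"
    and bc: "boundary_conditions d u a G" and eq: "scal_equation d u a f G c"
    and W: "open W" "polytope_of d u a \<subseteq> W" "\<And>k. Ck_on k W \<psi>"
  shows "2 * boundary_integral d u a (\<lambda>x. \<psi> x / f x ^ (2 * CARD('n) - 1))
    = c * polytope_integral d u a (\<lambda>x. \<psi> x / f x ^ (2 * CARD('n) + 1))
      + polytope_integral d u a
          (\<lambda>x. \<Sum>i\<in>UNIV. \<Sum>j\<in>UNIV. (1 / f x ^ (2 * CARD('n) - 1) * G x $ i $ j) * hessian \<psi> x $ i $ j)"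
proof -
  let ?\<Delta> = "polytope_of d u a" and ?N = "2 * CARD('n) - 1" and ?N' = "2 * CARD('n) + 1"
  have cpt: "compact ?\<Delta>" and int: "interior ?\<Delta> \<noteq> {}"
    using D by (simp_all add: labelled_delzant_def)
  obtain w b where f: "f = (\<lambda>x. w \<bullet> x + b)"
    using fa by (auto simp: affine_fun_on_def fun_eq_iff)
  obtain V1 H where V1: "open V1" "?\<Delta> \<subseteq> V1" and CH: "\<And>k. Ck_on k V1 H" and HG: "\<And>x. x \<in> ?\<Delta> \<Longrightarrow> H x = G x"
    using smG unfolding smooth_on_def by blast
  define V where "V = V1 \<inter> W \<inter> {x. 0 < f x}"
  have openV: "open V"
    unfolding V_def f by (intro open_Int V1 W open_Collect_less continuous_intros)
  have \<Delta>V: "?\<Delta> \<subseteq> V" using V1 W fpos by (auto simp: V_def)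
  have fV: "f x > 0" if "x \<in> V" for x using that by (simp add: V_def)
  have C\<psi>: "Ck_on k V \<psi>" for k
    using W(3) by (rule Ck_on_subset) (auto simp: V_def)
  have CHV: "Ck_on k V (\<lambda>x. H x $ i $ j)" for i j k
  proof -
    have "bounded_linear (\<lambda>A :: real ^ 'n ^ 'n. A $ i $ j)"
      by (rule bounded_linear_compose[OF bounded_linear_vec_nth bounded_linear_vec_nth])
    moreover have "Ck_on k V H"
      using CH by (rule Ck_on_subset) (auto simp: V_def)
    ultimately show ?thesis by (rule Ck_on_bounded_linear[OF openV])
  qed
  have Cinv: "Ck_on k V (\<lambda>x. 1 / f x ^ n)" for k n
  proof -
    have "Ck_on k V (\<lambda>x. inverse (f x ^ n))"
      using fV by (intro Ck_on_inverse Ck_on_power openV) (auto simp: f Ck_on_affine less_imp_neq[THEN not_sym])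
    then show ?thesis by (simp add: inverse_eq_divide)
  qed
  define p where "p = (\<lambda>x. 1 / f x ^ ?N)"
  have Cp: "Ck_on k V p" for k unfolding p_def by (rule Cinv)
  define h where "h = (\<lambda>i j x. p x * H x $ i $ j)"
  have Ch: "Ck_on k V (h i j)" for i j k
    unfolding h_def by (intro Ck_on_mult openV Cp CHV)
  have Cpart: "Ck_on k V (partial i g)" if "\<And>k. Ck_on k V g" for i k and g :: "real ^ 'n \<Rightarrow> real"
    using that[of "Suc k"] by simp
  have diff: "g differentiable (at x)" if "\<And>k. Ck_on k V g" "x \<in> V" for x and g :: "real ^ 'n \<Rightarrow> real"
    using that(1)[of "Suc 0"] that(2) by simp
  have cont: "continuous_on ?\<Delta> g" if "\<And>k. Ck_on k V g" for g :: "real ^ 'n \<Rightarrow> real"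
    using Ck_on_imp_continuous_on[OF that] \<Delta>V by (rule continuous_on_subset)

  \<comment> \<open>The equation is imposed on the interior; by continuity the smooth extension satisfies it on
      all of the polytope.\<close>
  have scal: "(\<Sum>i\<in>UNIV. \<Sum>j\<in>UNIV. partial j (partial i (h i j)) x) = - (c * (1 / f x ^ ?N'))" if x: "x \<in> ?\<Delta>" for x
  proof (rule eq_on_polytope_if_eq_on_interior[OF int _ _ _ x])
    show "continuous_on ?\<Delta> (\<lambda>x. \<Sum>i\<in>UNIV. \<Sum>j\<in>UNIV. partial j (partial i (h i j)) x)"
      by (intro cont Ck_on_sum openV Cpart Ch)
    show "continuous_on ?\<Delta> (\<lambda>x. - (c * (1 / f x ^ ?N')))"
      by (intro cont Ck_on_minus Ck_on_mult Ck_on_const openV Cinv)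
    fix x assume x: "x \<in> interior ?\<Delta>"
    have "partial j (partial i (h i j)) x = partial j (partial i (\<lambda>x. 1 / f x ^ ?N * G x $ i $ j)) x" for i j
    proof (rule partial_cong[OF open_interior x], rule partial_cong[OF open_interior], assumption)
      fix y assume "y \<in> interior ?\<Delta>"
      then have "y \<in> ?\<Delta>" using interior_subset by blast
      then show "h i j y = 1 / f y ^ ?N * G y $ i $ j"
        by (simp add: h_def p_def HG)
    qed
    then show "(\<Sum>i\<in>UNIV. \<Sum>j\<in>UNIV. partial j (partial i (h i j)) x) = - (c * (1 / f x ^ ?N'))"
      using eq x unfolding scal_equation_def by (simp add: minus_equation_iff)
  qed

  \<comment> \<open>With h j i, not h i j, in the second sum, the first-order terms of the divergence cancel by
      renaming indices, although the extension H may fail to be symmetric away from the polytope.\<close>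
  define Y where "Y = (\<lambda>j x. \<psi> x * (\<Sum>i\<in>UNIV. partial i (h i j) x) - (\<Sum>i\<in>UNIV. h j i x * partial i \<psi> x))"
  have CY: "Ck_on k V (Y j)" for j k
    unfolding Y_def by (intro Ck_on_diff Ck_on_mult Ck_on_sum openV Cpart Ch C\<psi>)

  have divY: "(\<Sum>j\<in>UNIV. partial j (Y j) x)
      = - (c * (\<psi> x / f x ^ ?N')) - (\<Sum>i\<in>UNIV. \<Sum>j\<in>UNIV. h i j x * hessian \<psi> x $ i $ j)" if x: "x \<in> ?\<Delta>" for x
  proof -
    have xV: "x \<in> V" using x \<Delta>V by blast
    have pY: "partial j (Y j) x = (\<psi> x * (\<Sum>i\<in>UNIV. partial j (partial i (h i j)) x)
        + (\<Sum>i\<in>UNIV. partial j \<psi> x * partial i (h i j) x))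
        - ((\<Sum>i\<in>UNIV. h j i x * partial j (partial i \<psi>) x) + (\<Sum>i\<in>UNIV. partial j (h j i) x * partial i \<psi> x))" for j
    proof -
      have d1: "(\<lambda>x. \<Sum>i\<in>UNIV. partial i (h i j) x) differentiable (at x)"
        by (rule diff[OF _ xV]) (intro Ck_on_sum openV Cpart Ch)
      have d2: "(\<lambda>x. h j i x * partial i \<psi> x) differentiable (at x)" for i
        by (rule diff[OF _ xV]) (intro Ck_on_mult openV Cpart Ch C\<psi>)
      have d3: "(\<lambda>x. \<Sum>i\<in>UNIV. h j i x * partial i \<psi> x) differentiable (at x)"
        by (rule diff[OF _ xV]) (intro Ck_on_sum Ck_on_mult openV Cpart Ch C\<psi>)
      have d4: "(\<lambda>x. \<psi> x * (\<Sum>i\<in>UNIV. partial i (h i j) x)) differentiable (at x)"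
        by (rule diff[OF _ xV]) (intro Ck_on_sum Ck_on_mult openV Cpart Ch C\<psi>)
      have d\<psi>: "\<psi> differentiable (at x)" "partial i \<psi> differentiable (at x)" for i
        by (rule diff[OF _ xV], intro Cpart C\<psi>)+
      have dh: "h i k differentiable (at x)" "partial l (h i k) differentiable (at x)" for i k l
        by (rule diff[OF _ xV], intro Cpart Ch)+
      show ?thesis
        unfolding Y_def partial_diff[OF d4 d3] partial_mult[OF d\<psi>(1) d1] partial_sum[OF d2]
          partial_mult[OF dh(1) d\<psi>(2)] partial_sum[OF dh(2)]
        by (simp add: sum.distrib sum_distrib_left)
    qed
    have swap: "(\<Sum>j\<in>UNIV. \<Sum>i\<in>UNIV. partial j \<psi> x * partial i (h i j) x)
        = (\<Sum>j\<in>UNIV. \<Sum>i\<in>UNIV. partial j (h j i) x * partial i \<psi> x)"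
      by (subst sum.swap) (simp add: mult.commute)
    have "(\<Sum>j\<in>UNIV. partial j (Y j) x) = \<psi> x * (\<Sum>j\<in>UNIV. \<Sum>i\<in>UNIV. partial j (partial i (h i j)) x)
        - (\<Sum>j\<in>UNIV. \<Sum>i\<in>UNIV. h j i x * partial j (partial i \<psi>) x)"
      unfolding pY sum_subtractf sum.distrib swap by (simp add: sum_distrib_left)
    also have "(\<Sum>j\<in>UNIV. \<Sum>i\<in>UNIV. partial j (partial i (h i j)) x) = - (c * (1 / f x ^ ?N'))"
      by (subst sum.swap) (rule scal[OF x])
    also have "(\<Sum>j\<in>UNIV. \<Sum>i\<in>UNIV. h j i x * partial j (partial i \<psi>) x)
        = (\<Sum>i\<in>UNIV. \<Sum>j\<in>UNIV. h i j x * hessian \<psi> x $ i $ j)"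
    proof -
      have "h j i x = h i j x" for i j
        using arg_cong[OF sym[OF x], of "\<lambda>M. M $ i $ j"] HG[OF x] by (simp add: h_def transpose_def)
      then show ?thesis by (subst sum.swap) (simp add: hessian_def)
    qed
    finally show ?thesis by simp
  qed

  have flux: "(\<Sum>j\<in>UNIV. u k $ j * Y j x) = 2 * (\<psi> x / f x ^ ?N)" if k: "k < d" and x: "x \<in> facet d u a k" for k x
  proof -
    have x\<Delta>: "x \<in> ?\<Delta>" using x facet_subset by blast
    have xV: "x \<in> V" using x\<Delta> \<Delta>V by blast
    \<comment> \<open>Both the second sum of Y and the terms with a derivative of p contain H u, which vanishes on
        the facet.\<close>
    have Hu: "(\<Sum>j\<in>UNIV. H x $ i $ j * u k $ j) = 0" for i
    proof -
      have "G x *v u k = 0" using bc k x by (auto simp: boundary_conditions_def)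
      from arg_cong[OF this, of "\<lambda>v. v $ i"] show ?thesis
        by (simp add: matrix_vector_mult_def HG[OF x\<Delta>])
    qed
    have hu: "(\<Sum>j\<in>UNIV. u k $ j * h j i x) = 0" for i
    proof -
      have "h j i x = p x * H x $ i $ j" for j
        using arg_cong[OF sym[OF x\<Delta>], of "\<lambda>M. M $ i $ j"] HG[OF x\<Delta>] by (simp add: h_def transpose_def)
      then have "(\<Sum>j\<in>UNIV. u k $ j * h j i x) = p x * (\<Sum>j\<in>UNIV. H x $ i $ j * u k $ j)"
        by (simp add: sum_distrib_left mult_ac)
      then show ?thesis using Hu by simp
    qed
    note H' = Ck_on_Suc_has_derivative[OF CH[of "Suc 0"]]
    have xV1: "x \<in> V1" using xV by (simp add: V_def)
    define DH where "DH = frechet_derivative H (at x)"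
    have DH: "(H has_derivative DH) (at x)" unfolding DH_def by (rule H'[OF xV1])
    have pH: "partial i (\<lambda>x. H x $ i $ j) x = DH (axis i 1) $ i $ j" for i j
      by (rule partial_eq[OF bounded_linear.has_derivative[OF bounded_linear_vec_nth
            bounded_linear.has_derivative[OF bounded_linear_vec_nth DH]]])
    have ph: "partial i (h i j) x = p x * DH (axis i 1) $ i $ j + partial i p x * H x $ i $ j" for i j
      unfolding h_def using diff[OF Cp xV] diff[OF CHV xV] by (simp add: partial_mult pH)
    have "(\<Sum>j\<in>UNIV. \<Sum>i\<in>UNIV. u k $ j * partial i (h i j) x)
        = (\<Sum>i\<in>UNIV. \<Sum>j\<in>UNIV. u k $ j * partial i (h i j) x)"
      by (rule sum.swap)
    also have "\<dots> = (\<Sum>i\<in>UNIV. p x * (DH (axis i 1) *v u k) $ i + partial i p x * (\<Sum>j\<in>UNIV. H x $ i $ j * u k $ j))"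
      by (simp add: ph matrix_vector_mult_def sum_distrib_left sum.distrib algebra_simps)
    also have "\<dots> = p x * (\<Sum>i\<in>UNIV. (DH (axis i 1) *v u k) $ i)"
      by (simp add: Hu sum_distrib_left)
    also have "(\<Sum>i\<in>UNIV. (DH (axis i 1) *v u k) $ i) = 2"
      by (rule boundary_conditions_divergence[OF D bc HG k x DH])
    finally have div: "(\<Sum>j\<in>UNIV. \<Sum>i\<in>UNIV. u k $ j * partial i (h i j) x) = 2 * p x" by simp
    have "(\<Sum>j\<in>UNIV. u k $ j * Y j x) = \<psi> x * (\<Sum>j\<in>UNIV. \<Sum>i\<in>UNIV. u k $ j * partial i (h i j) x)
        - (\<Sum>j\<in>UNIV. \<Sum>i\<in>UNIV. u k $ j * (h j i x * partial i \<psi> x))"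
      by (simp add: Y_def right_diff_distrib sum_subtractf sum_distrib_left mult_ac)
    also have "(\<Sum>j\<in>UNIV. \<Sum>i\<in>UNIV. u k $ j * (h j i x * partial i \<psi> x))
        = (\<Sum>i\<in>UNIV. (\<Sum>j\<in>UNIV. u k $ j * h j i x) * partial i \<psi> x)"
      by (subst sum.swap) (simp add: sum_distrib_right mult.assoc)
    finally show ?thesis by (simp add: div hu p_def)
  qed

  have divergence: "polytope_integral d u a (partial j (Y j))
      = - (\<Sum>k<d. u k $ j * set_lebesgue_integral (hyperplane_measure (u k) (a k)) (facet d u a k) (Y j))" for j
  proof -
    have "polytope_integral d u a (\<lambda>x. frechet_derivative (Y j) (at x) (axis j 1))
      = - (\<Sum>k<d. (u k \<bullet> axis j 1) * set_lebesgue_integral (hyperplane_measure (u k) (a k)) (facet d u a k) (Y j))"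
    proof (rule polytope_divergence[OF cpt _ _ openV \<Delta>V])
      show "u k \<noteq> 0" if "k < d" for k using normal_nonzero[OF D that] .
      show "\<exists>y. label u a j y = 0 \<and> label u a k y \<noteq> 0" if "j < d" "k < d" "k \<noteq> j" for j k
        using facet_hyperplanes_distinct[OF D that] .
      show "(Y j has_derivative frechet_derivative (Y j) (at x)) (at x)" if "x \<in> V" for x
        using Ck_on_Suc_has_derivative[OF CY[of "Suc 0"] that] .
      show "continuous_on V (\<lambda>x. frechet_derivative (Y j) (at x) (axis j 1))"
        using Ck_on_imp_continuous_on[OF Cpart[OF CY, of 0]] by (simp add: partial_def[abs_def])
    qed
    then show ?thesis by (simp add: inner_axis partial_def[abs_def])
  qed

  have intY: "set_integrable (hyperplane_measure (u k) (a k)) (facet d u a k) (Y j)" if "k < d" for j k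
    by (rule set_integrable_facet[OF compact_facet[OF cpt]
          continuous_on_subset[OF cont[OF CY] facet_subset] normal_nonzero[OF D that]])
  have intp: "set_integrable lborel ?\<Delta> g" if "\<And>k. Ck_on k V g" for g :: "real ^ 'n \<Rightarrow> real"
    by (rule set_integrable_polytope[OF cpt cont[OF that]])
  have "polytope_integral d u a (\<lambda>x. \<Sum>j\<in>UNIV. partial j (Y j) x)
      = (\<Sum>j\<in>UNIV. polytope_integral d u a (partial j (Y j)))"
    unfolding polytope_integral_def by (intro set_integral_sum intp Cpart CY)
  also have "\<dots> = - (\<Sum>k<d. \<Sum>j\<in>UNIV. u k $ j * set_lebesgue_integral (hyperplane_measure (u k) (a k)) (facet d u a k) (Y j))"
    unfolding divergence sum_negf by (subst sum.swap) simp
  also have "\<dots> = - (\<Sum>k<d. set_lebesgue_integral (hyperplane_measure (u k) (a k)) (facet d u a k) (\<lambda>x. 2 * (\<psi> x / f x ^ ?N)))"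
  proof -
    have "(\<Sum>j\<in>UNIV. u k $ j * set_lebesgue_integral (hyperplane_measure (u k) (a k)) (facet d u a k) (Y j))
      = set_lebesgue_integral (hyperplane_measure (u k) (a k)) (facet d u a k) (\<lambda>x. 2 * (\<psi> x / f x ^ ?N))" if "k < d" for k
    proof -
      have "(\<Sum>j\<in>UNIV. u k $ j * set_lebesgue_integral (hyperplane_measure (u k) (a k)) (facet d u a k) (Y j))
        = set_lebesgue_integral (hyperplane_measure (u k) (a k)) (facet d u a k) (\<lambda>x. \<Sum>j\<in>UNIV. u k $ j * Y j x)"
        using intY[OF that] by (subst set_integral_sum) auto
      also have "\<dots> = set_lebesgue_integral (hyperplane_measure (u k) (a k)) (facet d u a k) (\<lambda>x. 2 * (\<psi> x / f x ^ ?N))"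
        using flux[OF that] by (intro set_lebesgue_integral_cong[OF facet_sets]) auto
      finally show ?thesis .
    qed
    then show ?thesis by simp
  qed
  also have "\<dots> = - (2 * boundary_integral d u a (\<lambda>x. \<psi> x / f x ^ ?N))"
    by (simp only: boundary_integral_def set_integral_mult_right sum_distrib_left)
  finally have lhs: "polytope_integral d u a (\<lambda>x. \<Sum>j\<in>UNIV. partial j (Y j) x)
     = - (2 * boundary_integral d u a (\<lambda>x. \<psi> x / f x ^ ?N))" .
  have Chess: "Ck_on k V (\<lambda>x. \<Sum>i\<in>UNIV. \<Sum>j\<in>UNIV. h i j x * hessian \<psi> x $ i $ j)" for k
    unfolding hessian_def by (simp, intro Ck_on_sum Ck_on_mult openV Ch Cpart C\<psi>)
  have C\<psi>f: "Ck_on k V (\<lambda>x. \<psi> x / f x ^ n)" for k n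
    using Ck_on_mult[OF openV C\<psi> Cinv] by simp
  have "polytope_integral d u a (\<lambda>x. \<Sum>j\<in>UNIV. partial j (Y j) x)
     = polytope_integral d u a (\<lambda>x. (- c) * (\<psi> x / f x ^ ?N') - (\<Sum>i\<in>UNIV. \<Sum>j\<in>UNIV. h i j x * hessian \<psi> x $ i $ j))"
    unfolding polytope_integral_def using divY by (intro set_lebesgue_integral_cong[OF polytope_sets]) auto
  also have "\<dots> = - c * polytope_integral d u a (\<lambda>x. \<psi> x / f x ^ ?N')
      - polytope_integral d u a (\<lambda>x. \<Sum>i\<in>UNIV. \<Sum>j\<in>UNIV. h i j x * hessian \<psi> x $ i $ j)"
    unfolding polytope_integral_def
    by (subst set_integral_diff(2)) (simp_all only: set_integral_mult_right set_integrable_mult_right intp Chess C\<psi>f)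
  also have "polytope_integral d u a (\<lambda>x. \<Sum>i\<in>UNIV. \<Sum>j\<in>UNIV. h i j x * hessian \<psi> x $ i $ j)
    = polytope_integral d u a (\<lambda>x. \<Sum>i\<in>UNIV. \<Sum>j\<in>UNIV. (1 / f x ^ ?N * G x $ i $ j) * hessian \<psi> x $ i $ j)"
    unfolding polytope_integral_def using HG
    by (intro set_lebesgue_integral_cong[OF polytope_sets]) (auto simp: h_def p_def)
  finally show ?thesis unfolding lhs by linarith
qed

section \<open>The Donaldson--Futaki invariant\<close>

lemma futaki_cong:
  assumes "\<And>x. x \<in> polytope_of d u a \<Longrightarrow> g x = h x"
  shows "futaki d u a f g = futaki d u a f h"
proof -
  have "boundary_integral d u a (\<lambda>x. g x / f x ^ n) = boundary_integral d u a (\<lambda>x. h x / f x ^ n)"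
       "polytope_integral d u a (\<lambda>x. g x / f x ^ n) = polytope_integral d u a (\<lambda>x. h x / f x ^ n)" for n
    by (auto intro!: boundary_integral_cong polytope_integral_cong simp: assms)
  then show ?thesis unfolding futaki_def by (simp only:)
qed

lemma hessian_affine: "hessian (\<lambda>x. v \<bullet> x + b) x = 0"
proof -
  have "partial i (\<lambda>x. v \<bullet> x + b) x = v \<bullet> axis i 1" for i x
    by (rule partial_eq[of _ "\<lambda>h. v \<bullet> h"]) (auto intro!: derivative_eq_intros)
  then have "partial i (\<lambda>x. v \<bullet> x + b) = (\<lambda>x. v \<bullet> axis i 1)" for i by (simp add: fun_eq_iff)
  then show ?thesis by (simp add: hessian_def vec_eq_iff)
qed

text \<open>
  With \<open>\<psi> = 1\<close> integration by parts determines \<open>c\<close>.  With that value, it expresses the invariant of a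
  smooth function as the integral of the product of \<open>H\<close> with the Hessian, up to a positive weight.
\<close>

theorem futaki_invariant_of_solution:
  fixes G :: "real ^ 'n::finite \<Rightarrow> real ^ 'n ^ 'n"
  assumes D: "labelled_delzant \<Lambda> d u a"
    and fa: "affine_fun_on UNIV f" and fpos: "\<And>x. x \<in> polytope_of d u a \<Longrightarrow> 0 < f x"
    and smG: "smooth_on (polytope_of d u a) G"
    and sym: "\<And>x. x \<in> polytope_of d u a \<Longrightarrow> transpose (G x) = G x"
    and bc: "boundary_conditions d u a G" and eq: "scal_equation d u a f G c"
  shows "0 < c" and "c = c_const d u a f"
    and "affine_fun_on (polytope_of d u a) \<phi> \<Longrightarrow> futaki d u a f \<phi> = 0"
    and "\<lbrakk>\<And>x. x \<in> interior (polytope_of d u a) \<Longrightarrow> pos_definite (G x);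
          smooth_on (polytope_of d u a) \<phi>; convex_on (polytope_of d u a) \<phi>\<rbrakk>
      \<Longrightarrow> 0 \<le> futaki d u a f \<phi> \<and> (futaki d u a f \<phi> = 0 \<longleftrightarrow> affine_fun_on (polytope_of d u a) \<phi>)"
proof -
  let ?\<Delta> = "polytope_of d u a" and ?N = "2 * CARD('n) - 1" and ?N' = "2 * CARD('n) + 1"
  have cpt: "compact ?\<Delta>" and int: "interior ?\<Delta> \<noteq> {}"
    using D by (simp_all add: labelled_delzant_def)
  have sub: "interior ?\<Delta> \<subseteq> ?\<Delta>" by (rule interior_subset)
  obtain w b where f: "f = (\<lambda>x. w \<bullet> x + b)"
    using fa by (auto simp: affine_fun_on_def fun_eq_iff)
  have contf: "continuous_on ?\<Delta> (\<lambda>x. 1 / f x ^ n)" for n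
    unfolding f using fpos by (intro continuous_intros) (auto simp: f less_imp_neq[THEN not_sym])
  note parts = weighted_integration_by_parts[OF D fa fpos smG sym bc eq]
  \<comment> \<open>the case of vanishing Hessian; v = 0 gives the constants\<close>
  have parts_affine: "2 * boundary_integral d u a (\<lambda>x. (v \<bullet> x + s) / f x ^ ?N)
      = c * polytope_integral d u a (\<lambda>x. (v \<bullet> x + s) / f x ^ ?N')" for v s
    using parts[of UNIV "\<lambda>x. v \<bullet> x + s"] by (simp add: hessian_affine Ck_on_affine polytope_integral_def)
  have one: "2 * boundary_integral d u a (\<lambda>x. 1 / f x ^ ?N) = c * polytope_integral d u a (\<lambda>x. 1 / f x ^ ?N')"
    using parts_affine[of 0 1] by simp
  have P: "0 < polytope_integral d u a (\<lambda>x. 1 / f x ^ ?N')"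
    by (rule polytope_integral_pos[OF cpt int contf]) (use fpos in simp)
  have B: "0 < boundary_integral d u a (\<lambda>x. 1 / f x ^ ?N)"
    by (rule boundary_integral_pos[OF D contf]) (use fpos in simp)
  show "0 < c" using one P B by (simp add: zero_less_mult_iff) (smt (verit) zero_less_mult_pos2)
  show c: "c = c_const d u a f" using one P by (simp add: c_const_def)
  have affine: "futaki d u a f \<phi> = 0" if aff: "affine_fun_on ?\<Delta> \<phi>" for \<phi>
  proof -
    obtain v s where "\<And>x. x \<in> ?\<Delta> \<Longrightarrow> \<phi> x = v \<bullet> x + s" using aff by (auto simp: affine_fun_on_def)
    then have "futaki d u a f \<phi> = futaki d u a f (\<lambda>x. v \<bullet> x + s)" by (rule futaki_cong)
    then show ?thesis using parts_affine by (simp add: futaki_def c)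
  qed
  then show "affine_fun_on ?\<Delta> \<phi> \<Longrightarrow> futaki d u a f \<phi> = 0" .
  assume pd: "\<And>x. x \<in> interior ?\<Delta> \<Longrightarrow> pos_definite (G x)"
    and sm\<phi>: "smooth_on ?\<Delta> \<phi>" and convex: "convex_on ?\<Delta> \<phi>"
  obtain W \<psi> where W: "open W" "?\<Delta> \<subseteq> W" and C\<psi>: "\<And>k. Ck_on k W \<psi>" and \<psi>: "\<And>x. x \<in> ?\<Delta> \<Longrightarrow> \<psi> x = \<phi> x"
    using sm\<phi> unfolding smooth_on_def by blast
  obtain V1 H where "?\<Delta> \<subseteq> V1" and CH: "Ck_on 0 V1 H" and HG: "\<And>x. x \<in> ?\<Delta> \<Longrightarrow> H x = G x"
    using smG unfolding smooth_on_def by blast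
  then have contG: "continuous_on ?\<Delta> G"
    using continuous_on_subset[of V1 H ?\<Delta>] by (simp cong: continuous_on_cong)
  define Q where "Q = (\<lambda>x. \<Sum>i\<in>UNIV. \<Sum>j\<in>UNIV. G x $ i $ j * hessian \<psi> x $ i $ j)"
  define R where "R = (\<lambda>x. \<Sum>i\<in>UNIV. \<Sum>j\<in>UNIV. (1 / f x ^ ?N * G x $ i $ j) * hessian \<psi> x $ i $ j)"
  have RQ: "R x = 1 / f x ^ ?N * Q x" for x
    by (simp add: R_def Q_def sum_distrib_left mult_ac)
  have C2: "Ck_on 2 (interior ?\<Delta>) \<psi>"
    using sub W(2) by (intro Ck_on_subset[OF C\<psi>]) (rule subset_trans)
  have conth: "continuous_on ?\<Delta> (\<lambda>x. hessian \<psi> x $ i $ j)" for i j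
  proof -
    have "Ck_on 0 W (partial j (partial i \<psi>))"
      using C\<psi>[of 2] by (simp add: numeral_2_eq_2)
    then show ?thesis using W(2) by (simp add: hessian_def continuous_on_subset)
  qed
  have contGij: "continuous_on ?\<Delta> (\<lambda>x. G x $ i $ j)" for i j
    by (rule bounded_linear.continuous_on[OF bounded_linear_vec_nth
          bounded_linear.continuous_on[OF bounded_linear_vec_nth contG]])
  have contR: "continuous_on ?\<Delta> R"
    unfolding R_def by (intro continuous_on_sum continuous_on_mult contf conth contGij)
  have fut: "futaki d u a f \<phi> = polytope_integral d u a R"
  proof -
    have "futaki d u a f \<phi> = futaki d u a f \<psi>" using \<psi> by (intro futaki_cong) simp
    also have "\<dots> = polytope_integral d u a R"
      using parts[OF _ _ W C\<psi>] by (simp add: futaki_def c R_def)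
    finally show ?thesis .
  qed
  have conv\<psi>: "convex_on (interior ?\<Delta>) \<psi>"
  proof (rule convex_onI[OF _ convex_interior[OF convex_polytope_of]])
    fix t :: real and x y
    assume t: "0 < t" "t < 1" and xy: "x \<in> interior ?\<Delta>" "y \<in> interior ?\<Delta>"
    then have "x \<in> ?\<Delta>" "y \<in> ?\<Delta>" using sub by auto
    moreover from this have "(1 - t) *\<^sub>R x + t *\<^sub>R y \<in> ?\<Delta>"
      using t by (intro convexD_alt convex_polytope_of) auto
    ultimately show "\<psi> ((1 - t) *\<^sub>R x + t *\<^sub>R y) \<le> (1 - t) * \<psi> x + t * \<psi> y"
      using convex_onD[OF convex, of t x y] t by (simp add: \<psi>)
  qed
  have hess: "0 \<le> v \<bullet> (hessian \<psi> x *v v)" if "x \<in> interior ?\<Delta>" for x v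
    using convex_on_imp_hessian_psd[OF open_interior that C2 conv\<psi>] .
  have psdG: "0 \<le> v \<bullet> (G x *v v)" if "x \<in> interior ?\<Delta>" for x v
    using pd[OF that] by (cases "v = 0") (auto simp: pos_definite_def less_imp_le)
  have Qpos: "0 \<le> Q x" if x: "x \<in> interior ?\<Delta>" for x
    unfolding Q_def using sym sub x by (intro sum_mult_psd_nonneg psdG hess) auto
  have Rpos: "0 \<le> R x" if "x \<in> ?\<Delta>" for x
  proof -
    \<comment> \<open>nonnegativity passes from the interior to the boundary as an equation between continuous functions\<close>
    have "R x = \<bar>R x\<bar>"
    proof (rule eq_on_polytope_if_eq_on_interior[OF int contR _ _ that])
      show "continuous_on ?\<Delta> (\<lambda>x. \<bar>R x\<bar>)" using contR by (rule continuous_on_rabs)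
      show "R x = \<bar>R x\<bar>" if "x \<in> interior ?\<Delta>" for x
        using Qpos[OF that] fpos[of x] that sub by (auto simp: RQ)
    qed
    then show ?thesis by linarith
  qed
  have "affine_fun_on ?\<Delta> \<phi>" if zero: "futaki d u a f \<phi> = 0"
  proof -
    have "hessian \<psi> x = 0" if x: "x \<in> interior ?\<Delta>" for x
    proof (rule quadratic_form_eq_0_imp_eq_0[OF transpose_hessian[OF open_interior x C2]])
      have "R x = 0"
        using polytope_integral_eq_0_imp[OF cpt contR Rpos _ x] zero fut by simp
      then have "Q x = 0" using fpos[of x] x sub by (auto simp: RQ)
      then show "v \<bullet> (hessian \<psi> x *v v) = 0" for v
        using sym pd[OF x] hess[OF x] x sub unfolding Q_def
        by (intro sum_mult_pos_definite_eq_0[of "G x"]) auto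
    qed
    then have "affine_fun_on (interior ?\<Delta>) \<psi>"
      using hessian_eq_0_imp_affine[OF open_interior convex_interior[OF convex_polytope_of] C2] by blast
    then obtain v s where vs: "\<And>x. x \<in> interior ?\<Delta> \<Longrightarrow> \<psi> x = v \<bullet> x + s"
      by (auto simp: affine_fun_on_def)
    have "\<psi> x = v \<bullet> x + s" if "x \<in> ?\<Delta>" for x
    proof (rule eq_on_polytope_if_eq_on_interior[OF int _ _ vs that])
      show "continuous_on ?\<Delta> \<psi>"
        using Ck_on_imp_continuous_on[OF C\<psi>[of 0]] W(2) by (rule continuous_on_subset)
    qed (auto intro!: continuous_intros)
    then show ?thesis using \<psi> unfolding affine_fun_on_def by metis
  qed
  then show "0 \<le> futaki d u a f \<phi> \<and> (futaki d u a f \<phi> = 0 \<longleftrightarrow> affine_fun_on ?\<Delta> \<phi>)"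
    using affine polytope_integral_nonneg[OF Rpos] fut by auto
qed

text \<open>
  On the interior the form is the inverse of a Hessian, hence symmetric and positive definite;
  symmetry extends to the boundary by continuity.
\<close>

lemma symplectic_potential_extension:
  fixes U :: "real ^ 'n::finite \<Rightarrow> real"
  assumes int: "interior (polytope_of d u a) \<noteq> {}" and U: "U \<in> symplectic_potentials d u a"
  obtains G where "smooth_on (polytope_of d u a) G" "boundary_conditions d u a G"
    "\<And>x. x \<in> interior (polytope_of d u a) \<Longrightarrow> G x = H_of U x"
    "\<And>x. x \<in> polytope_of d u a \<Longrightarrow> transpose (G x) = G x"
    "\<And>x. x \<in> interior (polytope_of d u a) \<Longrightarrow> pos_definite (G x)"
proof -
  let ?\<Delta> = "polytope_of d u a"
  obtain G where smG: "smooth_on ?\<Delta> G" and bc: "boundary_conditions d u a G"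
    and G: "\<And>x. x \<in> interior ?\<Delta> \<Longrightarrow> G x = H_of U x"
    using U by (auto simp: symplectic_potentials_def)
  have pdU: "pos_definite (hessian U x)" if "x \<in> interior ?\<Delta>" for x
    using U that by (simp add: symplectic_potentials_def)
  have smU: "smooth_on (interior ?\<Delta>) U" using U by (simp add: symplectic_potentials_def)
  then obtain W h where "interior ?\<Delta> \<subseteq> W" "Ck_on 2 W h" and h: "\<And>x. x \<in> interior ?\<Delta> \<Longrightarrow> h x = U x"
    unfolding smooth_on_def by blast
  then have "Ck_on 2 (interior ?\<Delta>) h" by (meson Ck_on_subset)
  then have C2: "Ck_on 2 (interior ?\<Delta>) U" using Ck_on_cong[of "interior ?\<Delta>" h U 2] h by simp
  have symint: "transpose (G x) = G x" if x: "x \<in> interior ?\<Delta>" for x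
    using transpose_matrix_inv[OF pos_definite_invertible[OF pdU[OF x]] transpose_hessian[OF open_interior x C2]]
    by (simp add: G[OF x] H_of_def)
  obtain V1 H where "?\<Delta> \<subseteq> V1" and CH: "Ck_on 0 V1 H" and HG: "\<And>x. x \<in> ?\<Delta> \<Longrightarrow> H x = G x"
    using smG unfolding smooth_on_def by blast
  then have contG: "continuous_on ?\<Delta> G"
    using continuous_on_subset[of V1 H ?\<Delta>] by (simp cong: continuous_on_cong)
  have "linear (transpose :: real ^ 'n ^ 'n \<Rightarrow> real ^ 'n ^ 'n)"
    by (rule linearI) (simp_all add: transpose_def vec_eq_iff)
  then have contT: "continuous_on ?\<Delta> (\<lambda>x. transpose (G x))"
    using contG linear_continuous_on_compose by blast
  show ?thesis
  proof (rule that[OF smG bc G])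
    show "transpose (G x) = G x" if "x \<in> ?\<Delta>" for x
      by (rule eq_on_polytope_if_eq_on_interior[OF int contT contG symint that])
    show "pos_definite (G x)" if "x \<in> interior ?\<Delta>" for x
      using pos_definite_matrix_inv[OF pdU[OF that]] by (simp add: G[OF that] H_of_def)
  qed
qed

lemma scal_equation_cong:
  assumes "\<And>x. x \<in> interior (polytope_of d u a) \<Longrightarrow> G x = H x" "scal_equation d u a f H c"
  shows "scal_equation d u a f G c"
proof -
  have "partial j (partial i (\<lambda>x. r x * G x $ i $ j)) x = partial j (partial i (\<lambda>x. r x * H x $ i $ j)) x"
    if x: "x \<in> interior (polytope_of d u a)" for i j x r
  proof (rule partial_cong[OF open_interior x], rule partial_cong[OF open_interior], assumption)
    fix y assume "y \<in> interior (polytope_of d u a)"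
    then show "r y * G y $ i $ j = r y * H y $ i $ j" by (simp add: assms(1))
  qed
  note * = this
  show ?thesis
    unfolding scal_equation_def
  proof
    fix \<xi> assume \<xi>: "\<xi> \<in> interior (polytope_of d u a)"
    show "- (\<Sum>i\<in>UNIV. \<Sum>j\<in>UNIV.
             partial j (partial i (\<lambda>x. 1 / f x ^ (2 * CARD('a) - 1) * G x $ i $ j)) \<xi>)
        = c / f \<xi> ^ (2 * CARD('a) + 1)"
      unfolding *[OF \<xi>] using assms(2) \<xi> unfolding scal_equation_def by (rule bspec)
  qed
qed

theorem theorem2:
  fixes \<Lambda> :: "(real ^ 'n::finite) set"
    and d :: nat
    and u :: "nat \<Rightarrow> real ^ 'n"
    and a :: "nat \<Rightarrow> real"
    and f :: "real ^ 'n \<Rightarrow> real"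
  defines "\<Delta> \<equiv> polytope_of d u a"
  assumes "CARD('n) \<ge> 2"
    and "labelled_delzant \<Lambda> d u a"
    and "affine_fun_on UNIV f"
    and "\<forall>\<xi>\<in>\<Delta>. 0 < f \<xi>"
  shows
    "(\<forall>(H :: real ^ 'n \<Rightarrow> real ^ 'n ^ 'n) (c :: real).
        smooth_on \<Delta> H \<and> (\<forall>\<xi>\<in>\<Delta>. transpose (H \<xi>) = H \<xi>) \<and>
        boundary_conditions d u a H \<and> scal_equation d u a f H c \<longrightarrow>
          0 < c \<and> c = c_const d u a f \<and>
          (\<forall>\<phi>. affine_fun_on \<Delta> \<phi> \<longrightarrow> futaki d u a f \<phi> = 0) \<and>
          ((\<forall>\<xi>\<in>interior \<Delta>. pos_definite (H \<xi>)) \<longrightarrow>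
             (\<forall>\<phi>. smooth_on \<Delta> \<phi> \<and> convex_on \<Delta> \<phi> \<longrightarrow>
                0 \<le> futaki d u a f \<phi> \<and> (futaki d u a f \<phi> = 0 \<longleftrightarrow> affine_fun_on \<Delta> \<phi>)))) \<and>
     (\<forall>U \<in> symplectic_potentials d u a.
        scal_equation d u a f (H_of U) (c_const d u a f) \<longrightarrow>
          (\<forall>\<phi>. smooth_on \<Delta> \<phi> \<and> convex_on \<Delta> \<phi> \<longrightarrow>
             0 \<le> futaki d u a f \<phi> \<and> (futaki d u a f \<phi> = 0 \<longleftrightarrow> affine_fun_on \<Delta> \<phi>)))"
proof (intro conjI allI impI ballI)
  have fpos: "\<And>x. x \<in> polytope_of d u a \<Longrightarrow> 0 < f x" using assms(5) by (simp add: \<Delta>_def)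
  note solution = futaki_invariant_of_solution[OF assms(3,4) fpos]
  {
    fix H :: "real ^ 'n \<Rightarrow> real ^ 'n ^ 'n" and c
    assume H: "smooth_on \<Delta> H \<and> (\<forall>\<xi>\<in>\<Delta>. transpose (H \<xi>) = H \<xi>) \<and>
        boundary_conditions d u a H \<and> scal_equation d u a f H c"
    then have H1: "smooth_on (polytope_of d u a) H" "boundary_conditions d u a H" "scal_equation d u a f H c"
      and H2: "\<And>x. x \<in> polytope_of d u a \<Longrightarrow> transpose (H x) = H x"
      by (simp_all add: \<Delta>_def)
    note sol = solution[OF _ H1(1) H2 H1(2,3)]
    show "0 < c" by (rule sol(1))
    show "c = c_const d u a f" by (rule sol(2))
    show "futaki d u a f \<phi> = 0" if "affine_fun_on \<Delta> \<phi>" for \<phi>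
      using sol(3) that by (simp add: \<Delta>_def)
    fix \<phi>
    assume pd: "\<forall>\<xi>\<in>interior \<Delta>. pos_definite (H \<xi>)" and \<phi>: "smooth_on \<Delta> \<phi> \<and> convex_on \<Delta> \<phi>"
    have "0 \<le> futaki d u a f \<phi> \<and> (futaki d u a f \<phi> = 0 \<longleftrightarrow> affine_fun_on \<Delta> \<phi>)"
      unfolding \<Delta>_def by (rule sol(4)) (use pd \<phi> in \<open>auto simp: \<Delta>_def\<close>)
    then show "0 \<le> futaki d u a f \<phi>" "futaki d u a f \<phi> = 0 \<longleftrightarrow> affine_fun_on \<Delta> \<phi>"
      by auto
  }
  {
    fix U \<phi>
    assume U: "U \<in> symplectic_potentials d u a" and eq: "scal_equation d u a f (H_of U) (c_const d u a f)"
      and \<phi>: "smooth_on \<Delta> \<phi> \<and> convex_on \<Delta> \<phi>"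
    have int: "interior (polytope_of d u a) \<noteq> {}" using assms(3) by (simp add: labelled_delzant_def)
    obtain G where G: "smooth_on (polytope_of d u a) G" "boundary_conditions d u a G"
      "\<And>x. x \<in> interior (polytope_of d u a) \<Longrightarrow> G x = H_of U x"
      "\<And>x. x \<in> polytope_of d u a \<Longrightarrow> transpose (G x) = G x"
      "\<And>x. x \<in> interior (polytope_of d u a) \<Longrightarrow> pos_definite (G x)"
      using symplectic_potential_extension[OF int U] by blast
    have "scal_equation d u a f G (c_const d u a f)"
      by (rule scal_equation_cong[OF G(3) eq])
    then have "0 \<le> futaki d u a f \<phi> \<and> (futaki d u a f \<phi> = 0 \<longleftrightarrow> affine_fun_on \<Delta> \<phi>)"
      unfolding \<Delta>_def using \<phi> by (intro solution(4)[OF _ G(1,4,2) _ G(5)]) (auto simp: \<Delta>_def)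
    then show "0 \<le> futaki d u a f \<phi>" "futaki d u a f \<phi> = 0 \<longleftrightarrow> affine_fun_on \<Delta> \<phi>"
      by auto
  }
qed

end
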